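(* Let $\alpha\in(0,1)$ and $k_i>0$ for $i=1,\dots,5$. Then the equilibrium state $e_0=(0,0,0,0,0)$ of the controlled fractional $5D$ Maxwell-Bloch system with $x_e=e_0$, i.e. $$D_t^{\alpha}x^1=x^3-k_1x^1,\quad D_t^{\alpha}x^2=x^4-k_2x^2,\quad D_t^{\alpha}x^3=x^1x^5-k_3x^3,\quad D_t^{\alpha}x^4=x^2x^5-k_4x^4,$$ $$D_t^{\alpha}x^5=-(x^1x^3+x^2x^4)-k_5x^5,$$ is locally asymptotically stable.
   Context: $D_t^{\alpha}$ denotes the Caputo fractional derivative of order $\alpha\in(0,1)$ with base point $0$, $D_t^{\alpha}f=J^{1-\alpha}f'$, where $J^{\beta}f(t)=\frac{1}{\Gamma(\beta)}\int_0^t(t-s)^{\beta-1}f(s)\,ds$. Superscripts on $x$ denote components. An initial value problem $D_t^\alpha x=f(x)$, $x(0)=x_0$ is understood through the equivalent Volterra equation $x(t)=x_0+\frac{1}{\Gamma(\alpha)}\int_0^t(t-s)^{\alpha-1}f(x(s))\,ds$ with $x$ continuous. An equilibrium state is a zero of the right-hand side. An equilibrium state $x_e$ is locally asymptotically stable if it is Lyapunov stable (for every $\varepsilon>0$ there is $\delta>0$ such that $\|x(0)-x_e\|<\delta$ implies $\|x(t)-x_e\|<\varepsilon$ for all $t\ge0$) and there is $\delta_0>0$ such that $\|x(0)-x_e\|<\delta_0$ implies $\lim_{t\to\infty}\|x(t)-x_e\|=0$. *)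

theory Defs
  imports "HOL-Analysis.Analysis"
begin

definition RL_integral :: "real \<Rightarrow> (real \<Rightarrow> 'a::euclidean_space) \<Rightarrow> real \<Rightarrow> 'a" where
  "RL_integral \<beta> f t =
     (1 / Gamma \<beta>) *\<^sub>R integral {0..t} (\<lambda>s. (t - s) powr (\<beta> - 1) *\<^sub>R f s)"

(* Solution on the whole half-line of the initial value problem D_t^alpha x = f(x), x(0) = x0,
   for the Caputo derivative with base point 0, in the sense of the equivalent Volterra equation.
   The values of x at negative times are irrelevant. *)
definition caputo_solution ::
  "real \<Rightarrow> ('a::euclidean_space \<Rightarrow> 'a) \<Rightarrow> 'a \<Rightarrow> (real \<Rightarrow> 'a) \<Rightarrow> bool" where
  "caputo_solution \<alpha> f x0 x \<longleftrightarrow>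
     continuous_on {0..} x \<and> (\<forall>t\<ge>0. x t = x0 + RL_integral \<alpha> (\<lambda>s. f (x s)) t)"

definition equilibrium_state :: "('a::euclidean_space \<Rightarrow> 'a) \<Rightarrow> 'a \<Rightarrow> bool" where
  "equilibrium_state f xe \<longleftrightarrow> f xe = 0"

(* A bound "for all t >= 0" presupposes that the solution exists for all t >= 0. The existence
   clauses make this explicit, so that neither notion holds vacuously when solutions blow up. *)
definition lyapunov_stable ::
  "real \<Rightarrow> ('a::euclidean_space \<Rightarrow> 'a) \<Rightarrow> 'a \<Rightarrow> bool" where
  "lyapunov_stable \<alpha> f xe \<longleftrightarrow>
     (\<forall>\<epsilon>>0. \<exists>\<delta>>0. \<forall>x0. norm (x0 - xe) < \<delta> \<longrightarrow>
        (\<exists>x. caputo_solution \<alpha> f x0 x) \<and>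
        (\<forall>x. caputo_solution \<alpha> f x0 x \<longrightarrow> (\<forall>t\<ge>0. norm (x t - xe) < \<epsilon>)))"

definition locally_attractive ::
  "real \<Rightarrow> ('a::euclidean_space \<Rightarrow> 'a) \<Rightarrow> 'a \<Rightarrow> bool" where
  "locally_attractive \<alpha> f xe \<longleftrightarrow>
     (\<exists>\<delta>\<^sub>0>0. \<forall>x0. norm (x0 - xe) < \<delta>\<^sub>0 \<longrightarrow>
        (\<exists>x. caputo_solution \<alpha> f x0 x) \<and>
        (\<forall>x. caputo_solution \<alpha> f x0 x \<longrightarrow> ((\<lambda>t. norm (x t - xe)) \<longlongrightarrow> 0) at_top))"

definition locally_asymptotically_stable ::
  "real \<Rightarrow> ('a::euclidean_space \<Rightarrow> 'a) \<Rightarrow> 'a \<Rightarrow> bool" where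
  "locally_asymptotically_stable \<alpha> f xe \<longleftrightarrow>
     lyapunov_stable \<alpha> f xe \<and> locally_attractive \<alpha> f xe"

(* The feedback control for the target state 0 contributes the terms - k_i x^i. *)
definition controlled_maxwell_bloch :: "real^5 \<Rightarrow> real^5 \<Rightarrow> real^5" where
  "controlled_maxwell_bloch k x = vector
     [x$3 - k$1 * x$1,
      x$4 - k$2 * x$2,
      x$1 * x$5 - k$3 * x$3,
      x$2 * x$5 - k$4 * x$4,
      - (x$1 * x$3 + x$2 * x$4) - k$5 * x$5]"

(* In the index type 5 the numeral 5 denotes 0, so 1, ..., 5 are exactly its five elements. *)
lemma UNIV_5: "(UNIV :: 5 set) = {1, 2, 3, 4, 5}"
proof -
  have "card {1, 2, 3, 4, 5 :: 5} = card (UNIV :: 5 set)" by simp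
  then show ?thesis by (metis card_subset_eq finite subset_UNIV)
qed

lemma vector_5:
  "(vector [a, b, c, d, e] :: ('a::zero)^5) $ 1 = a"
  "(vector [a, b, c, d, e] :: ('a::zero)^5) $ 2 = b"
  "(vector [a, b, c, d, e] :: ('a::zero)^5) $ 3 = c"
  "(vector [a, b, c, d, e] :: ('a::zero)^5) $ 4 = d"
  "(vector [a, b, c, d, e] :: ('a::zero)^5) $ 5 = e"
  unfolding vector_def by simp_all

end

theory Submission
  imports Defs
begin

text \<open>
  The linear part is triangular with negative diagonal, so everything reduces to the scalar equation
  \<open>u = u0 + J (h - l u)\<close>, where \<open>J\<close> is the Riemann-Liouville integral. Its relaxation function
  \<open>E = 1 - l J E\<close> is positive and decreasing because the Abel kernel is log-convex, and it tends to 0.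
  Comparing \<open>u\<close> with \<open>E\<close> bounds \<open>\<bar>u\<bar>\<close> by \<open>\<bar>u0\<bar> + sup \<bar>h\<bar> / l\<close>, and asymptotically by
  \<open>limsup \<bar>h\<bar> / l\<close>. As the nonlinearity is quadratic, a small ball is invariant, and inside it
  the bound on the last three components can be halved again and again.
\<close>

section \<open>Riemann-Liouville integrals\<close>

text \<open>Solutions are only continuous functions satisfying a Volterra equation, so the estimates
  come from the integral equation and not from a differential inequality or a Lyapunov function. Nor
  can the equation be restarted at a later time with a new initial value, since the memory always
  reaches back to 0. Asymptotic bounds therefore split the forcing at a time \<open>T\<close> and
  let the relaxation function discount what came before it. What tames the quadratic coupling is its
  pairing: each product joins one of components 1, 2 with one of components 3, 4, 5. With components
  1, 2 at most \<rho>, it acts on the other three like a linear term with coefficient at most 2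
  \<rho>, which the damping dominates for small \<rho>. Components 1 and 2 then solve scalar
  equations forced by components 3 and 4. Existence on the whole half-line is a separate matter, as
  a quadratic field is not globally Lipschitz. Solutions are taken from a globally Lipschitz
  truncation, and the invariance of the ball shows that the truncation never acts along
  them.\<close>

lemma integral_reflect_shift:
  fixes f :: "real \<Rightarrow> 'a::euclidean_space"
  shows "integral {a..b} (\<lambda>s. f (c - s)) = integral {c - b..c - a} f"
proof -
  have "integral {a..b} (\<lambda>s. f (c - s)) = integral {-b..-a} (f \<circ> (+) c)"
    using Henstock_Kurzweil_Integration.integral_reflect_real[of "-a" "-b" "\<lambda>s. f (c + s)"]
    by (simp add: comp_def)
  also have "\<dots> = integral {c - b..c - a} f"
    by (simp add: integral_shift_Icc_real)
  finally show ?thesis .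
qed

lemma abel_kernel_has_integral:
  assumes "0 < \<alpha>" "a \<le> (t::real)"
  shows "((\<lambda>s. (t - s) powr (\<alpha> - 1)) has_integral (t - a) powr \<alpha> / \<alpha>) {a..t}"
proof -
  have "((\<lambda>x. x powr (\<alpha> - 1)) has_integral ((t - a) powr \<alpha> / \<alpha>)) {0..t - a}"
    using has_integral_powr_from_0[of "\<alpha> - 1" "t - a"] assms by simp
  from this[folded has_integral_shift_Icc_real[of "\<lambda>x. x powr (\<alpha> - 1)" t _ "-t" "-a", simplified]]
  have "((\<lambda>x. (t + x) powr (\<alpha> - 1)) has_integral ((t - a) powr \<alpha> / \<alpha>)) {-t..-a}"
    by (simp add: comp_def)
  then show ?thesis
    using has_integral_reflect_real[of "\<lambda>x. (t + x) powr (\<alpha> - 1)" _ "-a" "-t"]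
    by (simp del: has_integral_reflect_real)
qed

text \<open>The kernel is integrable and \<open>f\<close> is bounded and measurable on a compact
  interval. Admitting \<open>b\<close> below \<open>t\<close> covers the memory of an initial
  segment as seen from a later time.\<close>

lemma abel_kernel_absolutely_integrable:
  fixes f :: "real \<Rightarrow> 'a::euclidean_space"
  assumes "0 < \<alpha>" "b \<le> t" "continuous_on {a..b} f"
  shows "(\<lambda>s. (t - s) powr (\<alpha> - 1) *\<^sub>R f s) absolutely_integrable_on {a..b}"
proof (cases "a \<le> b")
  case True
  have "(\<lambda>s. (t - s) powr (\<alpha> - 1)) integrable_on {a..b}"
    using abel_kernel_has_integral[of \<alpha> a t] assms True
    by (auto intro: integrable_subinterval_real[of _ a t])
  then have "(\<lambda>s. (t - s) powr (\<alpha> - 1)) absolutely_integrable_on {a..b}"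
    by (intro nonnegative_absolutely_integrable_1) auto
  moreover have "f \<in> borel_measurable (lebesgue_on {a..b})"
    using assms by (intro continuous_imp_measurable_on_sets_lebesgue) auto
  moreover have "bounded (f ` {a..b})"
    using assms by (intro compact_imp_bounded compact_continuous_image) auto
  moreover have "bilinear (\<lambda>y x. x *\<^sub>R (y::'a))"
    by (auto simp: bilinear_def linear_iff scaleR_left_distrib scaleR_right_distrib)
  ultimately show ?thesis
    using absolutely_integrable_bounded_measurable_product[of "\<lambda>y x. x *\<^sub>R (y::'a)" f "{a..b}"]
    by simp
qed auto

lemmas abel_kernel_integrable =
  set_lebesgue_integral_eq_integral(1)[OF abel_kernel_absolutely_integrable]

lemma RL_integral_0 [simp]: "RL_integral \<alpha> f 0 = 0"
  by (simp add: RL_integral_def)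

lemma RL_integral_cong:
  assumes "\<And>s. 0 \<le> s \<Longrightarrow> s \<le> t \<Longrightarrow> f s = g s"
  shows "RL_integral \<alpha> f t = RL_integral \<alpha> g t"
  unfolding RL_integral_def using assms by (auto intro!: integral_cong)

lemma RL_integral_const:
  assumes "0 < \<alpha>" "0 \<le> t"
  shows "RL_integral \<alpha> (\<lambda>s. c) t = (t powr \<alpha> / (\<alpha> * Gamma \<alpha>)) *\<^sub>R c"
  using integral_unique[OF has_integral_scaleR_left[OF abel_kernel_has_integral[OF assms], of c]]
  by (simp add: RL_integral_def field_simps)

lemma RL_integral_cmul: "RL_integral \<alpha> (\<lambda>s. c * f s) t = c * RL_integral \<alpha> f (t::real)"
  for c :: real
  using integral_mult_right[of "{0..t}" c "\<lambda>s. (t - s) powr (\<alpha> - 1) * f s"]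
  by (simp add: RL_integral_def mult.left_commute)

lemma RL_integral_diff:
  fixes f g :: "real \<Rightarrow> 'a::euclidean_space"
  assumes "0 < \<alpha>" "continuous_on {0..t} f" "continuous_on {0..t} g"
  shows "RL_integral \<alpha> (\<lambda>s. f s - g s) t = RL_integral \<alpha> f t - RL_integral \<alpha> g t"
  using abel_kernel_integrable[OF assms(1) order_refl assms(2)]
    abel_kernel_integrable[OF assms(1) order_refl assms(3)]
  by (simp add: RL_integral_def scaleR_right_diff_distrib integral_diff)

lemma RL_integral_norm_le:
  fixes f :: "real \<Rightarrow> 'a::euclidean_space"
  assumes "0 < \<alpha>" "continuous_on {0..t} f" "continuous_on {0..t} g"
    and le: "\<And>s. 0 \<le> s \<Longrightarrow> s \<le> t \<Longrightarrow> norm (f s) \<le> g s"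
  shows "norm (RL_integral \<alpha> f t) \<le> RL_integral \<alpha> g t"
proof -
  have "norm (integral {0..t} (\<lambda>s. (t - s) powr (\<alpha> - 1) *\<^sub>R f s))
      \<le> integral {0..t} (\<lambda>s. (t - s) powr (\<alpha> - 1) *\<^sub>R g s)"
    using assms
    by (intro integral_norm_bound_integral abel_kernel_integrable) (auto intro!: mult_left_mono)
  then show ?thesis
    using Gamma_real_pos[OF \<open>0 < \<alpha>\<close>] by (simp add: RL_integral_def divide_right_mono)
qed

lemma RL_integral_mono:
  fixes f g :: "real \<Rightarrow> real"
  assumes "0 < \<alpha>" "continuous_on {0..t} f" "continuous_on {0..t} g"
    and "\<And>s. 0 \<le> s \<Longrightarrow> s \<le> t \<Longrightarrow> f s \<le> g s"
  shows "RL_integral \<alpha> f t \<le> RL_integral \<alpha> g t"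
proof -
  have "integral {0..t} (\<lambda>s. (t - s) powr (\<alpha> - 1) *\<^sub>R f s)
      \<le> integral {0..t} (\<lambda>s. (t - s) powr (\<alpha> - 1) *\<^sub>R g s)"
    using assms by (intro integral_le abel_kernel_integrable) (auto intro!: mult_left_mono)
  then show ?thesis
    using Gamma_real_pos[OF \<open>0 < \<alpha>\<close>] by (simp add: RL_integral_def divide_right_mono)
qed

lemma RL_integral_vec_nth:
  fixes f :: "real \<Rightarrow> real ^ 'n"
  assumes "0 < \<alpha>" "continuous_on {0..t} f"
  shows "RL_integral \<alpha> f t $ i = RL_integral \<alpha> (\<lambda>s. f s $ i) t"
proof -
  have "integral {0..t} (\<lambda>s. (t - s) powr (\<alpha> - 1) *\<^sub>R f s) $ i
      = integral {0..t} (\<lambda>s. ((t - s) powr (\<alpha> - 1) *\<^sub>R f s) $ i)"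
    using integral_linear[OF abel_kernel_integrable[OF assms(1) order_refl assms(2)]
        bounded_linear_vec_nth[of i]]
    by (simp add: comp_def)
  then show ?thesis
    by (simp add: RL_integral_def)
qed

text \<open>The substitution s = t v fixes the interval and the singularity and leaves
  \<open>t\<close> only in a power and in the argument of \<open>f\<close>. In this form continuity
  in \<open>t\<close> follows by dominated convergence.\<close>

lemma RL_integral_scale:
  fixes f :: "real \<Rightarrow> 'a::euclidean_space"
  assumes "0 < \<alpha>" "0 \<le> t" "continuous_on {0..t} f"
  shows "RL_integral \<alpha> f t
    = (t powr \<alpha> / Gamma \<alpha>) *\<^sub>R integral {0..1} (\<lambda>v. (1 - v) powr (\<alpha> - 1) *\<^sub>R f (t * v))"
proof (cases "t = 0")
  case False
  with assms have t: "t > 0" by simp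
  have *: "((\<lambda>s. (t - s) powr (\<alpha> - 1) *\<^sub>R f s) has_integral
        integral {0..t} (\<lambda>s. (t - s) powr (\<alpha> - 1) *\<^sub>R f s)) (cbox 0 t)"
    using abel_kernel_integrable[OF assms(1) order_refl assms(3)]
    by (simp add: integrable_integral)
  have "((\<lambda>v. (t - t * v) powr (\<alpha> - 1) *\<^sub>R f (t * v)) has_integral
        (integral {0..t} (\<lambda>s. (t - s) powr (\<alpha> - 1) *\<^sub>R f s)) /\<^sub>R t) {0..1}"
    using has_integral_affinity'[OF * t, of 0] t by simp
  then have "((\<lambda>v. t powr (\<alpha> - 1) *\<^sub>R ((1 - v) powr (\<alpha> - 1) *\<^sub>R f (t * v))) has_integral
        (integral {0..t} (\<lambda>s. (t - s) powr (\<alpha> - 1) *\<^sub>R f s)) /\<^sub>R t) {0..1}"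
  proof (rule has_integral_eq[rotated])
    fix v :: real assume "v \<in> {0..1}"
    then have "(t - t * v) powr (\<alpha> - 1) = t powr (\<alpha> - 1) * (1 - v) powr (\<alpha> - 1)"
      using t powr_mult[of t "1 - v" "\<alpha> - 1"] by (simp add: algebra_simps)
    then show "(t - t * v) powr (\<alpha> - 1) *\<^sub>R f (t * v)
        = t powr (\<alpha> - 1) *\<^sub>R ((1 - v) powr (\<alpha> - 1) *\<^sub>R f (t * v))" by simp
  qed
  from integral_unique[OF this]
  have "t powr (\<alpha> - 1) *\<^sub>R integral {0..1} (\<lambda>v. (1 - v) powr (\<alpha> - 1) *\<^sub>R f (t * v))
      = (integral {0..t} (\<lambda>s. (t - s) powr (\<alpha> - 1) *\<^sub>R f s)) /\<^sub>R t"
    by (simp only: integral_cmul)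
  then have "t *\<^sub>R t powr (\<alpha> - 1) *\<^sub>R integral {0..1} (\<lambda>v. (1 - v) powr (\<alpha> - 1) *\<^sub>R f (t * v))
      = integral {0..t} (\<lambda>s. (t - s) powr (\<alpha> - 1) *\<^sub>R f s)"
    using t by simp
  moreover have "t * t powr (\<alpha> - 1) = t powr \<alpha>"
    using t by (simp add: powr_diff)
  ultimately have "t powr \<alpha> *\<^sub>R integral {0..1} (\<lambda>v. (1 - v) powr (\<alpha> - 1) *\<^sub>R f (t * v))
      = integral {0..t} (\<lambda>s. (t - s) powr (\<alpha> - 1) *\<^sub>R f s)"
    by simp
  then show ?thesis
    unfolding RL_integral_def
    by (metis (no_types, lifting) divide_inverse_commute inverse_eq_divide scaleR_scaleR)
qed (use assms in auto)

lemma continuous_on_RL_integral: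
  fixes f :: "real \<Rightarrow> 'a::euclidean_space"
  assumes "0 < \<alpha>" and f: "continuous_on {0..} f"
  shows "continuous_on {0..} (RL_integral \<alpha> f)"
proof -
  let ?I = "\<lambda>t. integral {0..1} (\<lambda>v. (1 - v) powr (\<alpha> - 1) *\<^sub>R f (t * v))"
  have cont: "continuous_on {0..1} (\<lambda>v. f (t * v))" if "0 \<le> t" for t
    using that by (intro continuous_on_compose2[OF f]) (auto intro!: continuous_intros)
  have "continuous_on {0..} ?I"
    unfolding continuous_on_sequentially
  proof (intro allI ballI impI, elim conjE)
    fix t :: "nat \<Rightarrow> real" and a assume a: "a \<in> {0..}" and t: "\<forall>n. t n \<in> {0..}" "t \<longlonglongrightarrow> a"
    have "bounded (range t)"
      using t(2) convergent_imp_bounded by (auto simp: convergent_def)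
    then obtain T where T: "\<And>n. t n \<le> T" "0 \<le> T"
      unfolding bounded_iff by (metis abs_ge_self abs_ge_zero order_trans rangeI real_norm_def)
    have "bounded (f ` {0..T})"
      by (intro compact_imp_bounded compact_continuous_image continuous_on_subset[OF f]) auto
    then obtain B where B: "\<And>s. 0 \<le> s \<Longrightarrow> s \<le> T \<Longrightarrow> norm (f s) \<le> B"
      unfolding bounded_iff by (metis atLeastAtMost_iff imageI)
    have "(\<lambda>n. ?I (t n)) \<longlonglongrightarrow> ?I a"
    proof (rule dominated_convergence(2))
      show "(\<lambda>v. (1 - v) powr (\<alpha> - 1) *\<^sub>R f (t n * v)) integrable_on {0..1}" for n
        using t by (intro abel_kernel_integrable assms cont) auto
      \<comment> \<open>One dominating function serves all \<open>t n\<close>, because v \<le> 1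
        keeps \<open>t n * v\<close> below \<open>T\<close>.\<close>
      show "(\<lambda>v. (1 - v) powr (\<alpha> - 1) *\<^sub>R B) integrable_on {0..1}"
        by (intro abel_kernel_integrable assms) auto
      fix v :: real assume v: "v \<in> {0..1}"
      show "norm ((1 - v) powr (\<alpha> - 1) *\<^sub>R f (t n * v)) \<le> (1 - v) powr (\<alpha> - 1) *\<^sub>R B" for n
      proof -
        have "t n * v \<le> T * 1" using v t T by (intro mult_mono) auto
        then have "norm (f (t n * v)) \<le> B" using v t by (intro B) auto
        then show ?thesis by (auto intro!: mult_left_mono)
      qed
      have "(\<lambda>n. f (t n * v)) \<longlonglongrightarrow> f (a * v)"
        using v t a by (intro continuous_on_tendsto_compose[OF f]) (auto intro!: tendsto_intros)
      then show "(\<lambda>n. (1 - v) powr (\<alpha> - 1) *\<^sub>R f (t n * v)) \<longlonglongrightarrow> (1 - v) powr (\<alpha> - 1) *\<^sub>R f (a * v)"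
        by (intro tendsto_intros)
    qed
    then show "(?I \<circ> t) \<longlonglongrightarrow> ?I a" by (simp add: comp_def)
  qed
  moreover have "continuous_on {0..} (\<lambda>t::real. t powr \<alpha>)"
    using assms by (intro continuous_on_powr') (auto intro: continuous_intros)
  moreover have "Gamma \<alpha> \<noteq> 0"
    using Gamma_real_pos[OF assms(1)] by simp
  ultimately have "continuous_on {0..} (\<lambda>t. (t powr \<alpha> / Gamma \<alpha>) *\<^sub>R ?I t)"
    by (intro continuous_on_scaleR continuous_on_divide continuous_on_const) auto
  then show ?thesis
    by (rule continuous_on_eq)
      (use assms continuous_on_subset[OF f] in \<open>auto intro!: RL_integral_scale[symmetric]\<close>)
qed

text \<open>With w = \<mu> (t - s) the integral becomes exp(\<mu> t) \<mu>^(-\<alpha>) times an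
  incomplete Gamma integral, at most \<open>Gamma \<alpha>\<close>, which cancels the normalisation.
  For large \<mu> the factor \<mu>^(-\<alpha>) makes the Volterra operator a contraction in an
  exponentially weighted norm.\<close>

lemma RL_integral_exp_le:
  assumes "0 < \<alpha>" "0 \<le> t" "0 < \<mu>"
  shows "RL_integral \<alpha> (\<lambda>s. exp (\<mu> * s)) t \<le> \<mu> powr (-\<alpha>) * exp (\<mu> * t)"
proof -
  define g where "g = (\<lambda>w::real. w powr (\<alpha> - 1) / exp w)"
  have G: "(g has_integral Gamma \<alpha>) {0..}"
    unfolding g_def by (rule Gamma_integral_real[OF assms(1)])
  have g_int: "g integrable_on {0..b}" for b
    using integrable_on_subinterval[of g "{0..}" 0 b] G by (auto simp: has_integral_iff)
  have le: "integral {0..\<mu> * t} g \<le> Gamma \<alpha>"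
    using integral_subset_le[of "{0..\<mu> * t}" "{0..}" g] G g_int integral_unique[OF G]
    by (auto simp: g_def has_integral_iff)
  have "((\<lambda>v. g (\<mu> * v)) has_integral (integral {0..\<mu> * t} g /\<^sub>R \<mu>)) {0..t}"
    using has_integral_affinity'[of g "integral {0..\<mu> * t} g" 0 "\<mu> * t" \<mu> 0] g_int[of "\<mu> * t"] assms
    by (simp add: has_integral_integral mult.assoc[symmetric])
  from integral_unique[OF this]
  have I: "integral {0..t} (\<lambda>s. g (\<mu> * (t - s))) = integral {0..\<mu> * t} g / \<mu>"
    using integral_reflect_shift[of 0 t "\<lambda>v. g (\<mu> * v)" t] by (simp add: field_simps)
  have "integral {0..t} (\<lambda>s. (t - s) powr (\<alpha> - 1) *\<^sub>R exp (\<mu> * s))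
      = integral {0..t} (\<lambda>s. (exp (\<mu> * t) * \<mu> powr (1 - \<alpha>)) * g (\<mu> * (t - s)))"
  proof (rule integral_cong)
    fix s assume "s \<in> {0..t}"
    then have "(\<mu> * (t - s)) powr (\<alpha> - 1) = \<mu> powr (\<alpha> - 1) * (t - s) powr (\<alpha> - 1)"
      using assms by (simp add: powr_mult)
    moreover have "\<mu> powr (1 - \<alpha>) * \<mu> powr (\<alpha> - 1) = 1"
      using assms by (simp add: powr_add[symmetric])
    moreover have "exp (\<mu> * s) = exp (\<mu> * t) / exp (\<mu> * (t - s))"
      by (simp add: exp_diff[symmetric] algebra_simps)
    ultimately show "(t - s) powr (\<alpha> - 1) *\<^sub>R exp (\<mu> * s)
        = (exp (\<mu> * t) * \<mu> powr (1 - \<alpha>)) * g (\<mu> * (t - s))"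
      by (simp add: g_def)
  qed
  also have "\<dots> = exp (\<mu> * t) * \<mu> powr (1 - \<alpha>) * (integral {0..\<mu> * t} g / \<mu>)"
    by (simp only: integral_mult_right I)
  also have "\<dots> \<le> exp (\<mu> * t) * \<mu> powr (1 - \<alpha>) * (Gamma \<alpha> / \<mu>)"
    using le assms by (intro mult_left_mono divide_right_mono) auto
  also have "\<dots> = exp (\<mu> * t) * \<mu> powr (-\<alpha>) * Gamma \<alpha>"
    using assms powr_add[of \<mu> "1" "-\<alpha>"] by (simp add: field_simps)
  finally show ?thesis
    using Gamma_real_pos[OF assms(1)] by (simp add: RL_integral_def field_simps)
qed

section \<open>Global existence for Lipschitz right-hand sides\<close>

text \<open>A Bielecki norm replaces short time steps: after weighting with exp(-\<mu> t), the
  Volterra operator contracts by 1/2 on the whole half-line at once. The hypothesis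
  \<open>f 0 = 0\<close> keeps the weighted image of a bounded function bounded.\<close>

theorem caputo_solution_exists_Lipschitz:
  fixes f :: "'a::euclidean_space \<Rightarrow> 'a"
  assumes \<alpha>: "0 < \<alpha>" and f0: "f 0 = 0"
    and lip: "\<And>x y. norm (f x - f y) \<le> L * norm (x - y)"
  shows "\<exists>x. caputo_solution \<alpha> f x0 x"
proof -
  define K where "K = max L 1"
  have K: "K > 0" "norm (f x - f y) \<le> K * norm (x - y)" for x y
    using order_trans[OF lip mult_right_mono[of L K "norm (x - y)"]] by (auto simp: K_def)
  have K': "norm (f x) \<le> K * norm x" for x
    using K(2)[of x 0] f0 by simp
  \<comment> \<open>Chosen so that K \<mu>^(-\<alpha>) = 1/2, the contraction factor.\<close>
  define \<mu> where "\<mu> = (2 * K) powr (1 / \<alpha>)"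
  have \<mu>: "\<mu> > 0" "K * \<mu> powr (-\<alpha>) = 1 / 2"
    using K \<alpha> by (auto simp: \<mu>_def powr_powr powr_minus field_simps)
  have cont_f: "continuous_on UNIV f"
  proof -
    have "K-lipschitz_on UNIV f"
      using K by (auto simp: lipschitz_on_def dist_norm)
    then show ?thesis by (rule lipschitz_on_continuous_on)
  qed
  define w where "w = (\<lambda>y (s::real). f (exp (\<mu> * s) *\<^sub>R y s))"
  have w: "continuous_on S (w y)" if "continuous_on S y" for S :: "real set" and y :: "real \<Rightarrow> 'a"
    unfolding w_def using that
    by (intro continuous_on_compose2[OF cont_f]) (auto intro!: continuous_intros)
  have wd: "norm (w y s - w z s) \<le> K * b * exp (\<mu> * s)" if "norm (y s - z s) \<le> b" for y z s b
  proof -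
    have "norm (w y s - w z s) \<le> K * (exp (\<mu> * s) * norm (y s - z s))"
      using K(2)[of "exp (\<mu> * s) *\<^sub>R y s" "exp (\<mu> * s) *\<^sub>R z s"]
      by (simp add: w_def scaleR_right_diff_distrib[symmetric])
    also have "\<dots> \<le> K * (exp (\<mu> * s) * b)"
      using that K by (intro mult_left_mono) auto
    finally show ?thesis by (simp add: ac_simps)
  qed
  have expb: "RL_integral \<alpha> (\<lambda>s. K * b * exp (\<mu> * s)) t \<le> b / 2 * exp (\<mu> * t)"
    if "0 \<le> t" "0 \<le> b" for b t
  proof -
    have "RL_integral \<alpha> (\<lambda>s. K * b * exp (\<mu> * s)) t \<le> K * b * (\<mu> powr (-\<alpha>) * exp (\<mu> * t))"
      unfolding RL_integral_cmul using that K \<mu> \<alpha>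
      by (intro mult_left_mono RL_integral_exp_le) auto
    also have "\<dots> = (K * \<mu> powr (-\<alpha>)) * b * exp (\<mu> * t)" by simp
    finally show ?thesis using \<mu> by simp
  qed
  define F where "F = (\<lambda>y t. exp (- \<mu> * t) *\<^sub>R (x0 + RL_integral \<alpha> (w y) t))"
  have F_diff: "norm (F y t - F z t) \<le> b / 2"
    if "0 \<le> t" "continuous_on {0..} y" "continuous_on {0..} z" "0 \<le> b"
      "\<And>s. 0 \<le> s \<Longrightarrow> norm (y s - z s) \<le> b" for y z t b
  proof -
    have c: "continuous_on {0..t} (w y)" "continuous_on {0..t} (w z)"
      using that by (auto intro!: w elim: continuous_on_subset)
    have "norm (RL_integral \<alpha> (w y) t - RL_integral \<alpha> (w z) t)
        = norm (RL_integral \<alpha> (\<lambda>s. w y s - w z s) t)"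
      using RL_integral_diff[OF \<alpha> c] by simp
    also have "\<dots> \<le> RL_integral \<alpha> (\<lambda>s. K * b * exp (\<mu> * s)) t"
      using that c by (intro RL_integral_norm_le \<alpha> wd) (auto intro!: continuous_intros)
    also have "\<dots> \<le> b / 2 * exp (\<mu> * t)"
      using that by (intro expb)
    finally have "exp (- \<mu> * t) * norm (RL_integral \<alpha> (w y) t - RL_integral \<alpha> (w z) t)
        \<le> exp (- \<mu> * t) * (b / 2 * exp (\<mu> * t))"
      by (intro mult_left_mono) auto
    also have "\<dots> = b / 2"
      by (simp add: exp_minus)
    finally show ?thesis
      by (simp add: F_def scaleR_right_diff_distrib[symmetric])
  qed
  have F0: "F (\<lambda>_. 0) t = exp (- \<mu> * t) *\<^sub>R x0" for t
    by (simp add: F_def w_def f0 RL_integral_def)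
  have F_cont: "continuous_on {0..} (F y)" if "continuous_on {0..} y" for y
    unfolding F_def using that
    by (intro continuous_intros continuous_on_RL_integral \<alpha> w)
  \<comment> \<open>The Banach space consists of functions on the whole line, so \<open>F y\<close>
    is extended to negative times by its value at 0. \<open>Bcontfun\<close> is meaningful only for
    a bounded continuous argument, which the next fact secures.\<close>
  define \<Phi> where "\<Phi> = (\<lambda>y :: real \<Rightarrow>\<^sub>C 'a. Bcontfun (\<lambda>t. F y (max 0 t)))"
  have \<Phi>: "apply_bcontfun (\<Phi> y) t = F y (max 0 t)" for y t
  proof -
    obtain b where b: "\<And>s. norm (apply_bcontfun y s) \<le> b"
      using bounded_apply_bcontfun[of y] by (auto simp: bounded_iff)
    then have b0: "0 \<le> b" by (meson norm_ge_zero order_trans)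
    have "norm (F y (max 0 t)) \<le> b / 2 + norm x0" for t
    proof -
      have "norm (F y (max 0 t) - F (\<lambda>_. 0) (max 0 t)) \<le> b / 2"
        using b b0 by (intro F_diff) auto
      moreover have "exp (- \<mu> * max 0 t) \<le> 1"
        using \<mu> by simp
      then have "norm (F (\<lambda>_. 0) (max 0 t)) \<le> norm x0"
        using mult_right_mono[of _ 1 "norm x0"] by (simp add: F0)
      ultimately show ?thesis
        using norm_triangle_sub[of "F y (max 0 t)" "F (\<lambda>_. 0) (max 0 t)"] by linarith
    qed
    then have "bounded (range (\<lambda>t. F y (max 0 t)))"
      by (auto simp: bounded_iff)
    moreover have "continuous_on UNIV (\<lambda>t. F y (max 0 t))"
      by (intro continuous_on_compose2[OF F_cont[of y]]) (auto intro!: continuous_intros)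
    ultimately show ?thesis
      unfolding \<Phi>_def by (subst Bcontfun_inverse) (auto simp: bcontfun_def)
  qed
  have "dist (\<Phi> y) (\<Phi> z) \<le> 1 / 2 * dist y z" for y z
  proof (rule dist_bound)
    fix t
    have "norm (F y (max 0 t) - F z (max 0 t)) \<le> dist y z / 2"
      using dist_bounded[of y _ z] by (intro F_diff) (auto simp: dist_norm)
    then show "dist (\<Phi> y t) (\<Phi> z t) \<le> 1 / 2 * dist y z"
      by (simp add: \<Phi> dist_norm)
  qed
  then obtain y where y: "\<Phi> y = y"
    using banach_fix_type[of "1/2" \<Phi>] by auto
  define x where "x = (\<lambda>t. exp (\<mu> * t) *\<^sub>R apply_bcontfun y t)"
  have "x t = x0 + RL_integral \<alpha> (\<lambda>s. f (x s)) t" if "0 \<le> t" for t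
  proof -
    have "apply_bcontfun y t = F y t"
      using \<Phi>[of y t] that y by simp
    then show ?thesis
      by (simp add: x_def F_def w_def exp_minus_inverse mult_exp_exp)
  qed
  moreover have "continuous_on {0..} x"
    unfolding x_def by (intro continuous_intros) auto
  ultimately show ?thesis
    by (auto simp: caputo_solution_def)
qed

section \<open>The fractional relaxation equation\<close>

text \<open>At the first zero \<open>t0\<close>, log-convexity of the kernel bounds the memory of \<open>u\<close> over \<open>[0, r]\<close> seen
  from \<open>t0\<close> by that seen from \<open>r\<close>. Taking for \<open>r\<close> the maximum point of \<open>u\<close> on a short interval before
  \<open>t0\<close>, the recent memory is too small to make \<open>u\<close> vanish.\<close>

lemma abel_volterra_positive:
  fixes u f :: "real \<Rightarrow> real"
  assumes \<alpha>: "0 < \<alpha>" "\<alpha> < 1" and l: "0 \<le> l" and u: "continuous_on {0..} u"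
    and eq: "\<And>t. 0 \<le> t \<Longrightarrow> u t = f t - l * RL_integral \<alpha> u t"
    and f0: "0 < f 0"
    and f: "\<And>s t. 0 < s \<Longrightarrow> s \<le> t \<Longrightarrow> (t / s) powr (\<alpha> - 1) * f s \<le> f t"
    and "0 \<le> t"
  shows "0 < u t"
proof (rule ccontr)
  assume neg: "\<not> 0 < u t"
  have \<Gamma>: "Gamma \<alpha> > 0"
    using Gamma_real_pos \<alpha> by simp
  define Z where "Z = {0..t} \<inter> u -` {..0}"
  have "closed Z"
    unfolding Z_def
    by (intro continuous_closed_preimage continuous_on_subset[OF u]) auto
  moreover have "Z \<noteq> {}" "bdd_below Z"
    using neg \<open>0 \<le> t\<close> by (auto simp: Z_def)
  ultimately have Z: "Inf Z \<in> Z"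
    by (intro closed_contains_Inf) auto
  define t0 where "t0 = Inf Z"
  have t0: "0 \<le> t0" "u t0 \<le> 0"
    using Z by (auto simp: Z_def t0_def)
  have pos: "0 < u s" if "0 \<le> s" "s < t0" for s
  proof (rule ccontr)
    assume "\<not> 0 < u s"
    then have "s \<in> Z" using that Z by (auto simp: Z_def t0_def)
    then show False using cInf_lower[of s Z] \<open>bdd_below Z\<close> that by (simp add: t0_def)
  qed
  have "u 0 > 0" using eq[of 0] f0 by simp
  then have "t0 > 0" using t0 by (cases "t0 = 0") auto
  have c: "\<alpha> * Gamma \<alpha> / (4 * (l + 1)) \<noteq> 0"
    using \<Gamma> \<alpha> l by (intro less_imp_neq[symmetric] divide_pos_pos mult_pos_pos) auto
  \<comment> \<open>The first term keeps \<open>r\<close> at least t0 / 2; the second makes the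
    weight of the memory over a window of length \<eta> smaller than 1/2.\<close>
  define \<eta> where "\<eta> = min (t0 / 2) ((\<alpha> * Gamma \<alpha> / (4 * (l + 1))) powr (1 / \<alpha>))"
  have \<eta>: "0 < \<eta>" "\<eta> \<le> t0 / 2"
    using \<open>t0 > 0\<close> c by (simp_all add: \<eta>_def)
  have "\<eta> powr \<alpha> \<le> ((\<alpha> * Gamma \<alpha> / (4 * (l + 1))) powr (1 / \<alpha>)) powr \<alpha>"
    using \<eta> \<alpha> by (intro powr_mono2) (auto simp: \<eta>_def)
  also have "\<dots> = \<alpha> * Gamma \<alpha> / (4 * (l + 1))"
    using \<alpha> \<Gamma> l by (simp add: powr_powr)
  finally have "l * \<eta> powr \<alpha> \<le> l * (\<alpha> * Gamma \<alpha> / (4 * (l + 1)))"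
    using l by (intro mult_left_mono)
  then have "l * (\<eta> powr \<alpha> / (\<alpha> * Gamma \<alpha>)) \<le> l / (4 * (l + 1))"
    using \<alpha> \<Gamma> l by (simp add: field_simps)
  also have "\<dots> < 1 / 2" using l by (simp add: field_simps)
  finally have small: "l * (\<eta> powr \<alpha> / (\<alpha> * Gamma \<alpha>)) < 1 / 2" .
  obtain r where r: "r \<in> {t0 - \<eta>..t0}" "\<And>s. s \<in> {t0 - \<eta>..t0} \<Longrightarrow> u s \<le> u r"
    using continuous_attains_sup[of "{t0 - \<eta>..t0}" u] continuous_on_subset[OF u, of "{t0 - \<eta>..t0}"] \<eta>
    by auto
  have "0 < u (t0 - \<eta>)" using \<eta> by (intro pos) auto
  also have "\<dots> \<le> u r" using \<eta> by (intro r) auto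
  finally have "0 < u r" .
  with t0 r \<eta> have r': "r < t0" "0 < r"
    by (auto simp: less_le)
  \<comment> \<open>Since t0 / r \<le> 2 and \<alpha> - 1 \<ge> -1, this is at least 1/2. The same
    factor compares the two kernels on [0, r] and, by hypothesis, the inhomogeneities at
    \<open>r\<close> and \<open>t0\<close>.\<close>
  define q where "q = (t0 / r) powr (\<alpha> - 1)"
  have "2 powr (-1) \<le> (2::real) powr (\<alpha> - 1)"
    using \<alpha> by (intro powr_mono) auto
  also have "\<dots> \<le> q"
    unfolding q_def using r r' \<eta> \<alpha> by (intro powr_mono2') (auto simp: field_simps)
  finally have q: "1 / 2 \<le> q" by simp
  let ?k = "\<lambda>t s. (t - s) powr (\<alpha> - 1) * u s"
  have int: "?k t integrable_on {a..b}" if "0 \<le> a" "b \<le> t" for t a b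
    using abel_kernel_integrable[of \<alpha> b t a u] that continuous_on_subset[OF u, of "{a..b}"] \<alpha> by auto
  \<comment> \<open>The endpoint \<open>r\<close> must be left out: there the right-hand kernel is
    \<open>0 powr (\<alpha> - 1) = 0\<close>, and the pointwise inequality fails.\<close>
  have "integral {0<..<r} (?k t0) \<le> integral {0<..<r} (\<lambda>s. q * ?k r s)"
  proof (rule integral_le)
    show "?k t0 integrable_on {0<..<r}" "(\<lambda>s. q * ?k r s) integrable_on {0<..<r}"
      using int[of 0 r t0] int[of 0 r r] r' by (auto simp: integrable_on_open_interval_real intro!: integrable_on_mult_right)
    fix s assume s: "s \<in> {0<..<r}"
    have "(t0 - s) powr (\<alpha> - 1) \<le> (t0 / r * (r - s)) powr (\<alpha> - 1)"
      using s r' \<alpha> by (intro powr_mono2') (auto simp: field_simps)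
    also have "\<dots> = q * (r - s) powr (\<alpha> - 1)"
      using s r' by (simp add: q_def powr_mult[symmetric])
    finally have "(t0 - s) powr (\<alpha> - 1) * u s \<le> q * (r - s) powr (\<alpha> - 1) * u s"
      using pos[of s] s r' by (intro mult_right_mono) auto
    then show "?k t0 s \<le> q * ?k r s" by simp
  qed
  then have I1: "integral {0..r} (?k t0) \<le> q * integral {0..r} (?k r)"
    by (simp add: integral_open_interval_real)
  have "integral {r..t0} (?k t0) \<le> integral {r..t0} (\<lambda>s. (t0 - s) powr (\<alpha> - 1) * u r)"
    using r r' \<alpha> abel_kernel_has_integral[of \<alpha> r t0]
    by (intro integral_le int) (auto intro!: mult_left_mono integrable_on_mult_left dest: has_integral_integrable)
  also have "\<dots> = (t0 - r) powr \<alpha> / \<alpha> * u r"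
    using abel_kernel_has_integral[of \<alpha> r t0] \<alpha> r' by (simp add: integral_unique)
  also have "\<dots> \<le> \<eta> powr \<alpha> / \<alpha> * u r"
    using \<alpha> r r' \<open>0 < u r\<close> by (intro mult_right_mono divide_right_mono powr_mono2) auto
  finally have I2: "integral {r..t0} (?k t0) \<le> \<eta> powr \<alpha> / \<alpha> * u r" .
  have "integral {0..t0} (?k t0) = integral {0..r} (?k t0) + integral {r..t0} (?k t0)"
    using r' by (intro Henstock_Kurzweil_Integration.integral_combine[symmetric] int) auto
  also have "\<dots> \<le> q * integral {0..r} (?k r) + \<eta> powr \<alpha> / \<alpha> * u r"
    by (intro add_mono I1 I2)
  finally have "RL_integral \<alpha> u t0 \<le> q * RL_integral \<alpha> u r + \<eta> powr \<alpha> / (\<alpha> * Gamma \<alpha>) * u r"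
    using \<Gamma> by (simp add: RL_integral_def field_simps)
  then have "l * RL_integral \<alpha> u t0 \<le> l * (q * RL_integral \<alpha> u r + \<eta> powr \<alpha> / (\<alpha> * Gamma \<alpha>) * u r)"
    using l by (intro mult_left_mono)
  then have "u t0 \<ge> f t0 - q * (l * RL_integral \<alpha> u r) - l * (\<eta> powr \<alpha> / (\<alpha> * Gamma \<alpha>)) * u r"
    using eq[of t0] t0 by (simp add: algebra_simps)
  moreover have fr: "q * f r = q * u r + q * (l * RL_integral \<alpha> u r)"
    using eq[of r] r' by (simp add: distrib_left[symmetric])
  moreover have "q * f r \<le> f t0"
    unfolding q_def using r' by (intro f) auto
  \<comment> \<open>The memory over [0, r] cancels against \<open>q * f r\<close>. What remains is a
    multiple of \<open>u r\<close> whose coefficient is positive, the recent memory weighing less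
    than 1/2 \<le> q.\<close>
  ultimately have "u t0 \<ge> q * u r - l * (\<eta> powr \<alpha> / (\<alpha> * Gamma \<alpha>)) * u r"
    unfolding fr by linarith
  moreover have "l * (\<eta> powr \<alpha> / (\<alpha> * Gamma \<alpha>)) * u r < q * u r"
    using less_le_trans[OF small q] \<open>0 < u r\<close> by (rule mult_strict_right_mono)
  ultimately show False using t0 by simp
qed

text \<open>\<open>E\<close> is the Mittag-Leffler function E_\<alpha>(-l t^\<alpha>), fixed here by
  its Volterra equation instead of its power series.\<close>

locale fractional_relaxation =
  fixes \<alpha> l :: real and E :: "real \<Rightarrow> real"
  assumes \<alpha>: "0 < \<alpha>" "\<alpha> < 1" and l: "0 < l"
    and E_cont: "continuous_on {0..} E"
    and E_eq: "0 \<le> t \<Longrightarrow> E t = 1 - l * RL_integral \<alpha> E t"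
begin

lemma E_cont_on: "continuous_on {a..b} E" if "0 \<le> a"
  using E_cont that by (auto elim: continuous_on_subset)

lemma E_0: "E 0 = 1"
  using E_eq[of 0] by simp

lemma E_pos: "0 \<le> t \<Longrightarrow> 0 < E t"
proof (rule abel_volterra_positive[where f = "\<lambda>_. 1" and u = E and l = l])
  fix s t :: real assume "0 < s" "s \<le> t"
  then show "(t / s) powr (\<alpha> - 1) * 1 \<le> 1"
    using powr_mono[of "\<alpha> - 1" 0 "t / s"] \<alpha> by simp
qed (use \<alpha> l E_cont E_eq in auto)

lemma RL_integral_E_pos:
  assumes "0 < t" shows "0 < RL_integral \<alpha> E t"
proof -
  obtain r where r: "r \<in> {0..t}" "\<And>s. s \<in> {0..t} \<Longrightarrow> E r \<le> E s"
    using continuous_attains_inf[of "{0..t}" E] E_cont_on assms by auto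
  have "0 < RL_integral \<alpha> (\<lambda>_. E r) t"
    using r \<alpha> assms E_pos[of r] Gamma_real_pos[of \<alpha>] by (auto simp: RL_integral_const)
  also have "\<dots> \<le> RL_integral \<alpha> E t"
    using r by (intro RL_integral_mono \<alpha> E_cont_on) auto
  finally show ?thesis .
qed

text \<open>The decrement D(t) = E(t) - E(t + \<tau>) solves a Volterra equation of the same kind,
  whose inhomogeneity is the memory of the segment [0, \<tau>] seen from t + \<tau>. That memory
  fades no faster than t^(\<alpha> - 1), so the positivity criterion applies to
  \<open>D\<close>.\<close>

lemma E_decreasing:
  assumes "0 \<le> s" "s \<le> t" shows "E t \<le> E s"
proof (cases "s = t")
  case False
  define \<tau> where "\<tau> = t - s"
  have \<tau>: "0 < \<tau>" using assms False by (simp add: \<tau>_def)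
  have \<Gamma>: "Gamma \<alpha> > 0"
    using Gamma_real_pos \<alpha> by simp
  define D where "D = (\<lambda>t. E t - E (t + \<tau>))"
  define f where "f = (\<lambda>t. l / Gamma \<alpha> * integral {0..\<tau>} (\<lambda>s. (t + \<tau> - s) powr (\<alpha> - 1) * E s))"
  have shift: "continuous_on {0..} (\<lambda>s. E (s + \<tau>))"
    using \<tau> by (intro continuous_on_compose2[OF E_cont]) (auto intro!: continuous_intros)
  have int: "(\<lambda>s. (t - s) powr (\<alpha> - 1) * E s) integrable_on {a..b}" if "0 \<le> a" "b \<le> t" for t a b
    using abel_kernel_integrable[of \<alpha> b t a E] that E_cont_on \<alpha> by auto
  have eq: "D t = f t - l * RL_integral \<alpha> D t" if "0 \<le> t" for t
  proof -
    have D: "RL_integral \<alpha> D t = RL_integral \<alpha> E t - RL_integral \<alpha> (\<lambda>s. E (s + \<tau>)) t"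
      unfolding D_def using shift \<alpha>
      by (intro RL_integral_diff E_cont_on) (auto elim: continuous_on_subset)
    have "integral {0..t + \<tau>} (\<lambda>s. (t + \<tau> - s) powr (\<alpha> - 1) * E s)
        = integral {0..\<tau>} (\<lambda>s. (t + \<tau> - s) powr (\<alpha> - 1) * E s)
        + integral {\<tau>..t + \<tau>} (\<lambda>s. (t + \<tau> - s) powr (\<alpha> - 1) * E s)"
      using that \<tau> by (intro Henstock_Kurzweil_Integration.integral_combine[symmetric] int) auto
    moreover have "integral {\<tau>..t + \<tau>} (\<lambda>s. (t + \<tau> - s) powr (\<alpha> - 1) * E s)
        = integral {0..t} (\<lambda>s. (t - s) powr (\<alpha> - 1) * E (s + \<tau>))"
      using integral_shift_Icc_real[of 0 t "\<lambda>s. (t + \<tau> - s) powr (\<alpha> - 1) * E s" \<tau>]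
      by (simp add: comp_def add.commute)
    moreover have "integral {0..t} (\<lambda>s. (t - s) powr (\<alpha> - 1) * g s) = Gamma \<alpha> * RL_integral \<alpha> g t" for t g
      using \<Gamma> by (simp add: RL_integral_def)
    ultimately have "integral {0..\<tau>} (\<lambda>s. (t + \<tau> - s) powr (\<alpha> - 1) * E s)
        = Gamma \<alpha> * (RL_integral \<alpha> E (t + \<tau>) - RL_integral \<alpha> (\<lambda>s. E (s + \<tau>)) t)"
      by (simp add: algebra_simps)
    then have "f t = l * (RL_integral \<alpha> E (t + \<tau>) - RL_integral \<alpha> E t + RL_integral \<alpha> D t)"
      using \<Gamma> D by (simp add: f_def)
    then show ?thesis
      using E_eq[of t] E_eq[of "t + \<tau>"] that \<tau> by (simp add: D_def algebra_simps)
  qed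
  have "0 < D s"
  proof (rule abel_volterra_positive[where \<alpha> = \<alpha> and f = f and l = l and u = D and t = s])
    show "continuous_on {0..} D"
      unfolding D_def by (intro continuous_intros E_cont shift)
    show "0 < f 0"
      using mult_pos_pos[OF l RL_integral_E_pos[OF \<tau>]] by (simp add: f_def RL_integral_def)
    fix r t :: real assume r: "0 < r" "r \<le> t"
    have "integral {0..\<tau>} (\<lambda>s. (t / r) powr (\<alpha> - 1) * ((r + \<tau> - s) powr (\<alpha> - 1) * E s))
        \<le> integral {0..\<tau>} (\<lambda>s. (t + \<tau> - s) powr (\<alpha> - 1) * E s)"
    proof (rule integral_le)
      fix s assume s: "s \<in> {0..\<tau>}"
      \<comment> \<open>Stretching r + (\<tau> - s) by t / r \<ge> 1 turns \<open>r\<close> into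
        \<open>t\<close> and also enlarges \<tau> - s, so the result is at least t + \<tau> -
        s.\<close>
      have "1 * (\<tau> - s) \<le> t / r * (\<tau> - s)"
        using r s by (intro mult_right_mono) auto
      then have "t + \<tau> - s \<le> t / r * (r + \<tau> - s)"
        using r by (simp add: field_simps)
      then have "(t / r * (r + \<tau> - s)) powr (\<alpha> - 1) \<le> (t + \<tau> - s) powr (\<alpha> - 1)"
        using s r \<alpha> by (intro powr_mono2') auto
      then have "(t / r) powr (\<alpha> - 1) * (r + \<tau> - s) powr (\<alpha> - 1) \<le> (t + \<tau> - s) powr (\<alpha> - 1)"
        using s r powr_mult[of "t / r" "r + \<tau> - s" "\<alpha> - 1"] by simp
      then have "(t / r) powr (\<alpha> - 1) * (r + \<tau> - s) powr (\<alpha> - 1) * E s \<le> (t + \<tau> - s) powr (\<alpha> - 1) * E s"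
        using E_pos[of s] s by (intro mult_right_mono) auto
      then show "(t / r) powr (\<alpha> - 1) * ((r + \<tau> - s) powr (\<alpha> - 1) * E s) \<le> (t + \<tau> - s) powr (\<alpha> - 1) * E s"
        by simp
    qed (use r int[of 0 \<tau> "r + \<tau>"] int[of 0 \<tau> "t + \<tau>"] in auto)
    note le = this
    have "(t / r) powr (\<alpha> - 1) * f r
        = l / Gamma \<alpha> * ((t / r) powr (\<alpha> - 1) * integral {0..\<tau>} (\<lambda>s. (r + \<tau> - s) powr (\<alpha> - 1) * E s))"
      by (simp add: f_def)
    also have "\<dots> = l / Gamma \<alpha> * integral {0..\<tau>} (\<lambda>s. (t / r) powr (\<alpha> - 1) * ((r + \<tau> - s) powr (\<alpha> - 1) * E s))"
      by (simp only: integral_mult_right)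
    also have "\<dots> \<le> f t"
      unfolding f_def using l \<Gamma> by (intro mult_left_mono le) auto
    finally show "(t / r) powr (\<alpha> - 1) * f r \<le> f t" .
  qed (use \<alpha> l eq assms in auto)
  then show ?thesis by (simp add: D_def \<tau>_def)
qed simp

text \<open>As \<open>E\<close> is decreasing, its fractional integral at \<open>t\<close> is at
  least E(t) t^\<alpha> / (\<alpha> Gamma(\<alpha>)), while the equation caps \<open>l\<close> times
  that integral at 1. This gives decay of order t^(-\<alpha>).\<close>

lemma E_tendsto_0: "(E \<longlongrightarrow> 0) at_top"
proof (rule real_tendsto_sandwich)
  let ?c = "\<alpha> * Gamma \<alpha> / l"
  show "eventually (\<lambda>t. 0 \<le> E t) at_top"
    using eventually_ge_at_top[of 0] by eventually_elim (auto intro: less_imp_le[OF E_pos])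
  show "eventually (\<lambda>t. E t \<le> ?c * t powr (-\<alpha>)) at_top"
    using eventually_gt_at_top[of 0]
  proof eventually_elim
    case (elim t)
    have "RL_integral \<alpha> (\<lambda>_. E t) t \<le> RL_integral \<alpha> E t"
      using elim by (intro RL_integral_mono \<alpha> E_cont_on) (auto intro: E_decreasing)
    then have "l * (t powr \<alpha> / (\<alpha> * Gamma \<alpha>) * E t) \<le> l * RL_integral \<alpha> E t"
      using elim \<alpha> l by (intro mult_left_mono) (simp_all add: RL_integral_const)
    also have "\<dots> = 1 - E t"
      using elim E_eq[of t] by simp
    also have "\<dots> \<le> 1" using E_pos[of t] elim by simp
    finally show ?case
      using elim \<alpha> l Gamma_real_pos[of \<alpha>] by (simp add: powr_minus field_simps)
  qed
  have "((\<lambda>t. ?c * t powr (-\<alpha>)) \<longlongrightarrow> ?c * 0) at_top"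
    using \<alpha> by (intro tendsto_intros tendsto_neg_powr filterlim_ident) auto
  then show "((\<lambda>t. ?c * t powr (-\<alpha>)) \<longlongrightarrow> 0) at_top" by simp
qed simp

end

section \<open>Convolution with the Abel kernel\<close>

lemma abel_kernel_lborel:
  fixes g :: "real \<Rightarrow> real"
  assumes "0 < \<alpha>" "b \<le> t" "continuous_on UNIV g"
  shows "set_integrable lborel {a..b} (\<lambda>s. (t - s) powr (\<alpha> - 1) * g s)"
proof -
  have [measurable]: "g \<in> borel_measurable borel"
    using assms by (intro borel_measurable_continuous_onI)
  have "(\<lambda>s. (t - s) powr (\<alpha> - 1) * g s) absolutely_integrable_on {a..b}"
    using abel_kernel_absolutely_integrable[of \<alpha> b t a g] assms continuous_on_subset[OF assms(3), of "{a..b}"]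
    by simp
  then show ?thesis
    \<comment> \<open>Leaving the completed measure for \<open>lborel\<close>, where Fubini is
      applied, requires a Borel measurable integrand; continuity of \<open>g\<close> on the whole
      line provides it.\<close>
    unfolding set_integrable_def by (subst (asm) integrable_completion) auto
qed

text \<open>Up to the factor Gamma(\<alpha>), both sides integrate a(t - s) (s - r)^(\<alpha> - 1)
  g(r) over the triangle 0 \<le> r \<le> s \<le> t, in the two orders. This moves the fractional
  integral from the unknown solution onto \<open>E\<close>, where it is known.\<close>

lemma RL_integral_convolution:
  fixes a g :: "real \<Rightarrow> real"
  assumes \<alpha>: "0 < \<alpha>" and t: "0 \<le> t"
    and a: "continuous_on {0..} a" and g: "continuous_on {0..} g"
  shows "integral {0..t} (\<lambda>s. a (t - s) * RL_integral \<alpha> g s)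
    = integral {0..t} (\<lambda>s. RL_integral \<alpha> a (t - s) * g s)"
proof -
  \<comment> \<open>Freezing the functions at negative arguments makes them continuous on the line,
    hence Borel measurable, without changing either integral.\<close>
  define A where "A = (\<lambda>s. a (max 0 s))"
  define G where "G = (\<lambda>s. g (max 0 s))"
  have A_cont: "continuous_on S A" and G_cont: "continuous_on S G" for S
    unfolding A_def G_def
    by (intro continuous_on_compose2[OF a] continuous_on_compose2[OF g]; auto intro!: continuous_intros)+
  have AG[measurable]: "A \<in> borel_measurable borel" "G \<in> borel_measurable borel"
    by (intro borel_measurable_continuous_onI A_cont G_cont)+
  have At: "continuous_on {0..t} (\<lambda>s. A (t - s))"
    by (rule continuous_on_compose2[OF A_cont[where S = UNIV]]) (auto intro!: continuous_intros)
  have AJ: "RL_integral \<alpha> A s = RL_integral \<alpha> a s" and GJ: "RL_integral \<alpha> G s = RL_integral \<alpha> g s" for s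
    by (intro RL_integral_cong; simp add: A_def G_def)+
  have J_cont: "continuous_on {0..} (RL_integral \<alpha> A)" "continuous_on {0..} (RL_integral \<alpha> G)"
    by (intro continuous_on_RL_integral \<alpha> A_cont G_cont)+
  have \<Gamma>: "Gamma \<alpha> > 0" using Gamma_real_pos \<alpha> .
  define \<Phi> where "\<Phi> = (\<lambda>s r. if 0 \<le> r \<and> r \<le> s \<and> s \<le> t
      then A (t - s) * ((s - r) powr (\<alpha> - 1) * G r) else 0)"
  have \<Phi>_meas[measurable]: "case_prod \<Phi> \<in> borel_measurable (lborel \<Otimes>\<^sub>M lborel)"
    unfolding \<Phi>_def by measurable
  have \<Phi>_s: "\<Phi> s = (\<lambda>r. A (t - s) * (indicator {0..s} r *\<^sub>R ((s - r) powr (\<alpha> - 1) * G r)))"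
    if "s \<in> {0..t}" for s
    using that by (auto simp: \<Phi>_def indicator_def fun_eq_iff)
  have \<Phi>_s': "\<Phi> s = (\<lambda>r. 0)" if "s \<notin> {0..t}" for s
    using that by (auto simp: \<Phi>_def fun_eq_iff)
  have int_s: "integrable lborel (\<Phi> s)" for s
    using abel_kernel_lborel[OF \<alpha> order_refl G_cont, of 0 s]
    by (cases "s \<in> {0..t}") (simp_all add: \<Phi>_s \<Phi>_s' set_integrable_def)
  have norm_s: "(\<integral>r. norm (\<Phi> s r) \<partial>lborel)
      = indicator {0..t} s *\<^sub>R (\<bar>A (t - s)\<bar> * (Gamma \<alpha> * RL_integral \<alpha> (\<lambda>r. \<bar>G r\<bar>) s))" for s
  proof (cases "s \<in> {0..t}")
    case True
    have "(\<integral>r. norm (\<Phi> s r) \<partial>lborel)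
        = (\<integral>r. \<bar>A (t - s)\<bar> * (indicator {0..s} r *\<^sub>R ((s - r) powr (\<alpha> - 1) * \<bar>G r\<bar>)) \<partial>lborel)"
      using True by (intro Bochner_Integration.integral_cong) (auto simp: \<Phi>_s abs_mult indicator_def)
    also have "\<dots> = \<bar>A (t - s)\<bar> * (LINT r:{0..s}|lborel. (s - r) powr (\<alpha> - 1) * \<bar>G r\<bar>)"
      by (simp add: set_lebesgue_integral_def)
    also have "(LINT r:{0..s}|lborel. (s - r) powr (\<alpha> - 1) * \<bar>G r\<bar>) = Gamma \<alpha> * RL_integral \<alpha> (\<lambda>r. \<bar>G r\<bar>) s"
      using set_borel_integral_eq_integral(2)[OF abel_kernel_lborel[OF \<alpha> order_refl, of "\<lambda>r. \<bar>G r\<bar>" 0 s]] \<Gamma>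
        continuous_on_rabs[OF G_cont]
      by (simp add: RL_integral_def)
    finally show ?thesis using True by simp
  qed (simp add: \<Phi>_s')
  \<comment> \<open>Although the kernel is singular on the diagonal, the inner integrals of the
    modulus are continuous in \<open>s\<close>. That is the integrability which Fubini asks
    for.\<close>
  have "continuous_on {0..t} (\<lambda>s. \<bar>A (t - s)\<bar> * (Gamma \<alpha> * RL_integral \<alpha> (\<lambda>r. \<bar>G r\<bar>) s))"
    by (intro continuous_intros At
        continuous_on_subset[OF continuous_on_RL_integral[OF \<alpha> continuous_on_rabs[OF G_cont]]]) auto
  then have "integrable lborel (\<lambda>s. \<integral>r. norm (\<Phi> s r) \<partial>lborel)"
    unfolding norm_s by (rule borel_integrable_atLeastAtMost'[unfolded set_integrable_def])
  then have \<Phi>_int: "integrable (lborel \<Otimes>\<^sub>M lborel) (case_prod \<Phi>)"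
    using int_s by (intro lborel_pair.Fubini_integrable) auto
  have I1: "(\<integral>r. \<Phi> s r \<partial>lborel) = indicator {0..t} s *\<^sub>R (A (t - s) * (Gamma \<alpha> * RL_integral \<alpha> G s))" for s
  proof (cases "s \<in> {0..t}")
    case True
    have "(\<integral>r. \<Phi> s r \<partial>lborel) = A (t - s) * (LINT r:{0..s}|lborel. (s - r) powr (\<alpha> - 1) * G r)"
      using True by (simp add: \<Phi>_s set_lebesgue_integral_def)
    also have "(LINT r:{0..s}|lborel. (s - r) powr (\<alpha> - 1) * G r) = Gamma \<alpha> * RL_integral \<alpha> G s"
      using set_borel_integral_eq_integral(2)[OF abel_kernel_lborel[OF \<alpha> order_refl G_cont, of 0 s]] \<Gamma>
      by (simp add: RL_integral_def)
    finally show ?thesis using True by simp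
  qed (simp add: \<Phi>_s')
  have I2: "(\<integral>s. \<Phi> s r \<partial>lborel) = indicator {0..t} r *\<^sub>R (Gamma \<alpha> * RL_integral \<alpha> A (t - r) * G r)" for r
  proof (cases "r \<in> {0..t}")
    case True
    \<comment> \<open>The reflection s = t - v puts the singularity at the upper endpoint v = t - r,
      as in \<open>RL_integral\<close>.\<close>
    have "(\<integral>s. \<Phi> s r \<partial>lborel) = (\<integral>v. \<Phi> (t - v) r \<partial>lborel)"
      using lborel_integral_real_affine[of "-1" "\<lambda>s. \<Phi> s r" t] by simp
    also have "\<dots> = (\<integral>v. indicator {0..t - r} v *\<^sub>R ((t - r - v) powr (\<alpha> - 1) * A v) * G r \<partial>lborel)"
      using True
      by (intro Bochner_Integration.integral_cong) (auto simp: \<Phi>_def indicator_def algebra_simps)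
    also have "\<dots> = (LINT v:{0..t - r}|lborel. (t - r - v) powr (\<alpha> - 1) * A v) * G r"
      by (simp add: set_lebesgue_integral_def)
    also have "(LINT v:{0..t - r}|lborel. (t - r - v) powr (\<alpha> - 1) * A v) = Gamma \<alpha> * RL_integral \<alpha> A (t - r)"
      using set_borel_integral_eq_integral(2)[OF abel_kernel_lborel[OF \<alpha> order_refl A_cont, of 0 "t - r"]] \<Gamma>
      by (simp add: RL_integral_def)
    finally show ?thesis using True by simp
  next
    case False
    then have "\<Phi> s r = 0" for s by (auto simp: \<Phi>_def)
    then show ?thesis using False by simp
  qed
  have c1: "continuous_on {0..t} (\<lambda>s. A (t - s) * (Gamma \<alpha> * RL_integral \<alpha> G s))"
    by (intro continuous_intros At continuous_on_subset[OF J_cont(2)]) auto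
  have c2: "continuous_on {0..t} (\<lambda>r. Gamma \<alpha> * RL_integral \<alpha> A (t - r) * G r)"
    by (intro continuous_intros continuous_on_compose2[OF J_cont(1)] G_cont) auto
  have "integral {0..t} (\<lambda>s. A (t - s) * (Gamma \<alpha> * RL_integral \<alpha> G s))
      = (LINT s:{0..t}|lborel. A (t - s) * (Gamma \<alpha> * RL_integral \<alpha> G s))"
    by (intro set_borel_integral_eq_integral(2)[symmetric] borel_integrable_atLeastAtMost' c1)
  also have "\<dots> = (\<integral>s. (\<integral>r. \<Phi> s r \<partial>lborel) \<partial>lborel)"
    by (simp add: I1 set_lebesgue_integral_def)
  also have "\<dots> = (\<integral>r. (\<integral>s. \<Phi> s r \<partial>lborel) \<partial>lborel)"
    by (rule lborel_pair.Fubini_integral[OF \<Phi>_int, symmetric])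
  also have "\<dots> = (LINT r:{0..t}|lborel. Gamma \<alpha> * RL_integral \<alpha> A (t - r) * G r)"
    by (simp add: I2 set_lebesgue_integral_def)
  also have "\<dots> = integral {0..t} (\<lambda>r. Gamma \<alpha> * RL_integral \<alpha> A (t - r) * G r)"
    by (intro set_borel_integral_eq_integral(2) borel_integrable_atLeastAtMost' c2)
  finally have "Gamma \<alpha> * integral {0..t} (\<lambda>s. A (t - s) * RL_integral \<alpha> G s)
      = Gamma \<alpha> * integral {0..t} (\<lambda>r. RL_integral \<alpha> A (t - r) * G r)"
    by (simp only: integral_mult_right[symmetric] mult.left_commute mult.assoc)
  then have "integral {0..t} (\<lambda>s. A (t - s) * RL_integral \<alpha> G s)
      = integral {0..t} (\<lambda>r. RL_integral \<alpha> A (t - r) * G r)"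
    using \<Gamma> by simp
  moreover have "integral {0..t} (\<lambda>s. A (t - s) * RL_integral \<alpha> G s) = integral {0..t} (\<lambda>s. a (t - s) * RL_integral \<alpha> g s)"
    by (intro integral_cong) (simp add: GJ, simp add: A_def)
  moreover have "integral {0..t} (\<lambda>s. RL_integral \<alpha> A (t - s) * G s) = integral {0..t} (\<lambda>s. RL_integral \<alpha> a (t - s) * g s)"
    by (intro integral_cong) (simp add: AJ, simp add: G_def)
  ultimately show ?thesis by simp
qed

section \<open>Variation of constants for the forced relaxation equation\<close>

context fractional_relaxation
begin

text \<open>The integrated variation-of-constants formula: convolve the equation with \<^term>\<open>E\<close> and use
  \<open>l J E = 1 - E\<close>. Integrating avoids the resolvent \<open>- E' / l\<close>, which is singular at 0.\<close>

lemma integral_solution: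
  fixes u h :: "real \<Rightarrow> real"
  assumes u: "continuous_on {0..} u" and h: "continuous_on {0..} h" and "0 \<le> t"
    and eq: "\<And>t. 0 \<le> t \<Longrightarrow> u t = u0 + RL_integral \<alpha> (\<lambda>s. h s - l * u s) t"
  shows "integral {0..t} u = u0 * integral {0..t} E + integral {0..t} (\<lambda>s. (1 - E (t - s)) / l * h s)"
proof -
  have E': "continuous_on {0..t} (\<lambda>s. E (t - s))"
    by (intro continuous_on_compose2[OF E_cont]) (auto intro!: continuous_intros)
  have uh: "continuous_on {0..t} u" "continuous_on {0..t} h"
    using u h by (auto elim: continuous_on_subset)
  note c = E' uh
  have int: "(\<lambda>s. E (t - s)) integrable_on {0..t}" "(\<lambda>s. E (t - s) * u s) integrable_on {0..t}"
    "(\<lambda>s. (1 - E (t - s)) / l * h s) integrable_on {0..t}" "u integrable_on {0..t}"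
    using l by (intro integrable_continuous_real continuous_intros c; simp)+
  have "integral {0..t} (\<lambda>s. E (t - s) * RL_integral \<alpha> (\<lambda>s. h s - l * u s) s)
      = integral {0..t} (\<lambda>s. RL_integral \<alpha> E (t - s) * (h s - l * u s))"
    using \<open>0 \<le> t\<close> by (intro RL_integral_convolution \<alpha> E_cont continuous_intros u h)
  also have "integral {0..t} (\<lambda>s. E (t - s) * RL_integral \<alpha> (\<lambda>s. h s - l * u s) s)
      = integral {0..t} (\<lambda>s. E (t - s) * u s - u0 * E (t - s))"
    using eq by (intro integral_cong) (auto simp: algebra_simps)
  also have "\<dots> = integral {0..t} (\<lambda>s. E (t - s) * u s) - u0 * integral {0..t} (\<lambda>s. E (t - s))"
    using integral_diff[OF int(2) integrable_on_mult_right[OF int(1), of u0]] by simp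
  also have "integral {0..t} (\<lambda>s. E (t - s)) = integral {0..t} E"
    using integral_reflect_shift[of 0 t E t] by simp
  also have "integral {0..t} (\<lambda>s. RL_integral \<alpha> E (t - s) * (h s - l * u s))
      = integral {0..t} (\<lambda>s. (1 - E (t - s)) / l * h s - u s + E (t - s) * u s)"
  proof (rule integral_cong)
    fix s assume s: "s \<in> {0..t}"
    have J: "RL_integral \<alpha> E (t - s) = (1 - E (t - s)) / l"
      using E_eq[of "t - s"] s l by (simp add: field_simps)
    show "RL_integral \<alpha> E (t - s) * (h s - l * u s) = (1 - E (t - s)) / l * h s - u s + E (t - s) * u s"
      unfolding J using l by (simp add: field_simps)
  qed
  also have "\<dots> = integral {0..t} (\<lambda>s. (1 - E (t - s)) / l * h s) - integral {0..t} u
      + integral {0..t} (\<lambda>s. E (t - s) * u s)"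
    using int by (simp only: integral_diff integral_add integrable_diff)
  finally show ?thesis by simp
qed

end

context fractional_relaxation
begin

text \<open>The integrated formula at t is subtracted from that at t + \<eta>; divided by \<eta>,
  the difference gives \<open>u t\<close> up to an error that vanishes with \<eta>. \<open>N\<close>
  is the excess of the forcing before \<open>T\<close>: the factor E(t - T) forgets it, while
  \<open>M\<close> is passed on with the gain 1 / l.\<close>

lemma solution_bound:
  fixes u h :: "real \<Rightarrow> real"
  assumes u: "continuous_on {0..} u" and h: "continuous_on {0..} h"
    and eq: "\<And>t. 0 \<le> t \<Longrightarrow> u t = u0 + RL_integral \<alpha> (\<lambda>s. h s - l * u s) t"
    and t: "0 \<le> T" "T \<le> t" and N: "0 \<le> N"
    and h1: "\<And>s. 0 \<le> s \<Longrightarrow> s \<le> T \<Longrightarrow> \<bar>h s\<bar> \<le> N + M"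
    and h2: "\<And>s. T \<le> s \<Longrightarrow> s \<le> t \<Longrightarrow> \<bar>h s\<bar> \<le> M"
  shows "\<bar>u t\<bar> \<le> \<bar>u0\<bar> * E t + N * E (t - T) / l + M / l"
proof (rule field_le_epsilon)
  fix \<epsilon> :: real assume "0 < \<epsilon>"
  \<comment> \<open>On the half-line this is the fractional integral of \<open>E\<close>, the kernel
    of the integrated formula. It increases from 0 and stays below 1 / l.\<close>
  define G where "G = (\<lambda>s. (1 - E s) / l)"
  have G_cont: "continuous_on {0..} G"
    unfolding G_def using l by (intro continuous_intros E_cont) auto
  have G_cont_on: "continuous_on {a..b} G" if "0 \<le> a" for a b
    using that by (auto intro: continuous_on_subset[OF G_cont])
  have G_mono: "G r \<le> G s" if "0 \<le> r" "r \<le> s" for r s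
    unfolding G_def using l E_decreasing[OF that] by (intro divide_right_mono) auto
  have G_le: "G s \<le> 1 / l" if "0 \<le> s" for s
    unfolding G_def using l E_pos[OF that] by (intro divide_right_mono) auto
  have G_0: "G 0 = 0" by (simp add: G_def E_0)
  have G_ge: "0 \<le> G s" if "0 \<le> s" for s
    using G_mono[of 0 s] that by (simp add: G_0)
  have G_shift: "continuous_on {a..b} (\<lambda>s. G (c - s))" if "b \<le> c" for a b c
    using that by (intro continuous_on_compose2[OF G_cont]) (auto intro!: continuous_intros)
  have h_on: "continuous_on {a..b} h" if "0 \<le> a" for a b
    using that by (auto intro: continuous_on_subset[OF h])
  have u_on: "continuous_on {a..b} u" if "0 \<le> a" for a b
    using that by (auto intro: continuous_on_subset[OF u])
  note combine = Henstock_Kurzweil_Integration.integral_combine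
  have bounds: "integral {a..b} f \<le> (b - a) * c" if "continuous_on {a..b} f" "a \<le> b" "\<And>s. s \<in> {a..b} \<Longrightarrow> f s \<le> c"
    for a b c :: real and f
    using integral_le[of f "{a..b}" "\<lambda>_. c"] that by (auto intro: integrable_continuous_real)
  have bounds': "(b - a) * c \<le> integral {a..b} f" if "continuous_on {a..b} f" "a \<le> b" "\<And>s. s \<in> {a..b} \<Longrightarrow> c \<le> f s"
    for a b c :: real and f
    using integral_le[of "\<lambda>_. c" "{a..b}" f] that by (auto intro: integrable_continuous_real)
  \<comment> \<open>The window has the fixed length 1, since \<eta> is chosen only afterwards, small
    in terms of \<open>H\<close>.\<close>
  define H where "H = (SUP s\<in>{t..t+1}. \<bar>h s\<bar>)"
  have H: "\<bar>h s\<bar> \<le> H" if "t \<le> s" "s \<le> t + 1" for s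
  proof -
    have "bounded (h ` {t..t+1})"
      using t by (intro compact_imp_bounded compact_continuous_image h_on) auto
    then have "bdd_above ((\<lambda>s. \<bar>h s\<bar>) ` {t..t+1})"
      by (auto simp: bounded_iff bdd_above_def)
    then show ?thesis
      unfolding H_def using that by (intro cSUP_upper) auto
  qed
  have "0 \<le> H" using H[of t] by simp
  obtain \<eta> where \<eta>: "0 < \<eta>" "\<eta> \<le> 1" "G \<eta> * H \<le> \<epsilon> / 2" "\<And>s. t \<le> s \<Longrightarrow> s \<le> t + \<eta> \<Longrightarrow> \<bar>u s - u t\<bar> \<le> \<epsilon> / 2"
  proof -
    have near: "\<exists>d>0. \<forall>s\<ge>0. \<bar>s - a\<bar> < d \<longrightarrow> \<bar>f s - f a\<bar> < \<epsilon> / 2"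
      if "continuous_on {0..} f" "0 \<le> a" for f :: "real \<Rightarrow> real" and a
      using that \<open>0 < \<epsilon>\<close> unfolding continuous_on_iff dist_real_def
      by (metis atLeast_iff half_gt_zero)
    have "continuous_on {0..} (\<lambda>s. G s * H)"
      by (intro continuous_intros G_cont)
    from near[OF this order_refl] obtain d1 where d1: "d1 > 0" "\<And>s. 0 \<le> s \<Longrightarrow> \<bar>s\<bar> < d1 \<Longrightarrow> \<bar>G s * H\<bar> < \<epsilon> / 2"
      by (auto simp: G_0)
    from near[OF u, of t] t obtain d2
      where d2: "d2 > 0" "\<And>s. 0 \<le> s \<Longrightarrow> \<bar>s - t\<bar> < d2 \<Longrightarrow> \<bar>u s - u t\<bar> < \<epsilon> / 2"
      by auto
    define e where "e = min 1 (min (d1 / 2) (d2 / 2))"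
    have e: "0 < e" "e \<le> 1" "e < d1" "e < d2"
      using d1(1) d2(1) by (auto simp: e_def min_less_iff_disj)
    have "G e * H \<le> \<epsilon> / 2"
      using d1(2)[of e] e by auto
    moreover have "\<bar>u s - u t\<bar> \<le> \<epsilon> / 2" if "t \<le> s" "s \<le> t + e" for s
      using d2(2)[of s] e t that by auto
    ultimately show ?thesis
      using e that by blast
  qed
  \<comment> \<open>Divided by \<eta>, this difference quotient stands in for the resolvent. Only
    its sign and its integral enter the bound.\<close>
  define d where "d = (\<lambda>s. G (t + \<eta> - s) - G (t - s))"
  have d_cont: "continuous_on {a..b} d" if "b \<le> t" for a b
    unfolding d_def using that \<eta> by (intro continuous_intros G_shift) auto
  have d_ge: "0 \<le> d s" if "s \<le> t" for s
    unfolding d_def using that \<eta> by (simp add: G_mono)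
  have d_int: "integral {0..S} d \<le> \<eta> * (E (t - S) / l)" if S: "0 \<le> S" "S \<le> t" for S
  proof -
    have "integral {0..S} d = integral {0..S} (\<lambda>s. G (t + \<eta> - s)) - integral {0..S} (\<lambda>s. G (t - s))"
      unfolding d_def using S \<eta>
      by (intro integral_diff integrable_continuous_real G_shift) auto
    also have "integral {0..S} (\<lambda>s. G (t + \<eta> - s)) = integral {t + \<eta> - S..t + \<eta>} G"
      using integral_reflect_shift[of 0 S G "t + \<eta>"] by simp
    also have "integral {0..S} (\<lambda>s. G (t - s)) = integral {t - S..t} G"
      using integral_reflect_shift[of 0 S G t] by simp
    \<comment> \<open>The two intervals differ by a shift of \<eta>, so one end piece of length
      \<eta> survives on each side. The bounds 1 / l above and G(t - S) below for \<open>G\<close>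
      on these pieces differ by E(t - S) / l.\<close>
    also have "integral {t + \<eta> - S..t + \<eta>} G - integral {t - S..t} G
        = integral {t..t + \<eta>} G - integral {t - S..t - S + \<eta>} G"
      using combine[of "t - S" "t - S + \<eta>" "t + \<eta>" G] combine[of "t - S" t "t + \<eta>" G] S \<eta>
        integrable_continuous_real[OF G_cont_on, of "t - S" "t + \<eta>"]
      by (simp add: algebra_simps)
    also have "\<dots> \<le> \<eta> * (1 / l) - \<eta> * G (t - S)"
    proof (rule diff_mono)
      have "integral {t..t + \<eta>} G \<le> (t + \<eta> - t) * (1 / l)"
        using t \<eta> by (intro bounds G_cont_on G_le) auto
      then show "integral {t..t + \<eta>} G \<le> \<eta> * (1 / l)" by simp
      have "(t - S + \<eta> - (t - S)) * G (t - S) \<le> integral {t - S..t - S + \<eta>} G"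
        using S \<eta> by (intro bounds' G_cont_on G_mono) auto
      then show "\<eta> * G (t - S) \<le> integral {t - S..t - S + \<eta>} G" by simp
    qed
    also have "\<dots> = \<eta> * (E (t - S) / l)"
      using l by (simp add: G_def field_simps)
    finally show ?thesis .
  qed
  have past: "\<bar>integral {0..t} (\<lambda>s. d s * h s)\<bar> \<le> \<eta> * (N * E (t - T) / l + M / l)"
  proof -
    have dh: "continuous_on {a..b} (\<lambda>s. d s * h s)" if "0 \<le> a" "b \<le> t" for a b
      using that by (intro continuous_intros d_cont h_on)
    have "norm (integral {0..T} (\<lambda>s. d s * h s)) \<le> integral {0..T} (\<lambda>s. d s * (N + M))"
      using t d_ge h1
      by (intro integral_norm_bound_integral integrable_continuous_real dh continuous_intros d_cont)
        (auto simp: abs_mult intro!: mult_left_mono)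
    moreover have "norm (integral {T..t} (\<lambda>s. d s * h s)) \<le> integral {T..t} (\<lambda>s. d s * M)"
      using t d_ge h2
      by (intro integral_norm_bound_integral integrable_continuous_real dh continuous_intros d_cont)
        (auto simp: abs_mult intro!: mult_left_mono)
    ultimately have "\<bar>integral {0..t} (\<lambda>s. d s * h s)\<bar> \<le> integral {0..T} d * (N + M) + integral {T..t} d * M"
      using combine[of 0 T t "\<lambda>s. d s * h s"] t integrable_continuous_real[OF dh, of 0 t] by simp
    \<comment> \<open>The excess \<open>N\<close> counts only up to \<open>T\<close>, whereas
      \<open>M\<close> counts up to \<open>t\<close>, where the integral bound has the full factor
      E(0) = 1.\<close>
    also have "\<dots> = N * integral {0..T} d + M * integral {0..t} d"
      using combine[of 0 T t d] t integrable_continuous_real[OF d_cont, of t 0]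
      by (simp add: algebra_simps flip: distrib_left)
    also have "\<dots> \<le> N * (\<eta> * (E (t - T) / l)) + M * (\<eta> * (E (t - t) / l))"
    proof (intro add_mono mult_left_mono d_int)
      show "0 \<le> M" using h2[of t] t by simp
    qed (use t N in auto)
    also have "\<dots> = \<eta> * (N * E (t - T) / l + M / l)"
      by (simp add: E_0 algebra_simps)
    finally show ?thesis .
  qed
  \<comment> \<open>On the new piece the smallness comes from \<open>G 0 = 0\<close> through the
    choice of \<eta>.\<close>
  have recent: "\<bar>integral {t..t + \<eta>} (\<lambda>s. G (t + \<eta> - s) * h s)\<bar> \<le> \<eta> * (\<epsilon> / 2)"
  proof -
    have "norm (integral {t..t + \<eta>} (\<lambda>s. G (t + \<eta> - s) * h s)) \<le> (\<epsilon> / 2) * (t + \<eta> - t)"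
    proof (rule integral_bound)
      show "continuous_on {t..t + \<eta>} (\<lambda>s. G (t + \<eta> - s) * h s)"
        using t by (intro continuous_intros G_shift h_on) auto
      fix s assume s: "s \<in> {t..t + \<eta>}"
      have "\<bar>G (t + \<eta> - s)\<bar> * \<bar>h s\<bar> \<le> G \<eta> * H"
        using s \<eta> G_ge[of "t + \<eta> - s"] G_ge[of \<eta>]
        by (intro mult_mono H) (auto intro!: G_mono)
      then show "norm (G (t + \<eta> - s) * h s) \<le> \<epsilon> / 2"
        using \<eta> by (simp add: abs_mult)
    qed (use \<eta> in auto)
    then show ?thesis by (simp add: mult.commute)
  qed
  have "(t + \<eta> - t) * 0 \<le> integral {t..t + \<eta>} E"
    using t \<eta> by (intro bounds' E_cont_on less_imp_le[OF E_pos]) auto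
  moreover have "integral {t..t + \<eta>} E \<le> (t + \<eta> - t) * E t"
    using t \<eta> by (intro bounds E_cont_on E_decreasing) auto
  ultimately have "\<bar>integral {t..t + \<eta>} E\<bar> \<le> \<eta> * E t"
    by simp
  then have initial: "\<bar>u0 * integral {t..t + \<eta>} E\<bar> \<le> \<bar>u0\<bar> * (\<eta> * E t)"
    by (auto simp: abs_mult intro!: mult_left_mono)
  have average: "\<bar>integral {t..t + \<eta>} u - \<eta> * u t\<bar> \<le> \<eta> * (\<epsilon> / 2)"
  proof -
    have "norm (integral {t..t + \<eta>} (\<lambda>s. u s - u t)) \<le> (\<epsilon> / 2) * (t + \<eta> - t)"
      using t \<eta> by (intro integral_bound continuous_intros u_on) auto
    moreover have "integral {t..t + \<eta>} (\<lambda>s. u s - u t) = integral {t..t + \<eta>} u - \<eta> * u t"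
      using t \<eta> by (subst integral_diff) (auto intro!: integrable_continuous_real u_on)
    ultimately show ?thesis by (simp add: mult.commute)
  qed
  have increment: "integral {t..t + \<eta>} u = u0 * integral {t..t + \<eta>} E + integral {0..t} (\<lambda>s. d s * h s)
      + integral {t..t + \<eta>} (\<lambda>s. G (t + \<eta> - s) * h s)"
  proof -
    have sol: "integral {0..r} u = u0 * integral {0..r} E + integral {0..r} (\<lambda>s. G (r - s) * h s)"
      if "0 \<le> r" for r
      unfolding G_def by (rule integral_solution[OF u h that eq])
    have Gh: "continuous_on {a..b} (\<lambda>s. G (c - s) * h s)" if "0 \<le> a" "b \<le> c" for a b c
      using that by (intro continuous_intros G_shift h_on)
    have "integral {0..t} (\<lambda>s. d s * h s)
        = integral {0..t} (\<lambda>s. G (t + \<eta> - s) * h s) - integral {0..t} (\<lambda>s. G (t - s) * h s)"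
      unfolding d_def left_diff_distrib using t \<eta>
      by (intro integral_diff integrable_continuous_real Gh) auto
    moreover have "integral {0..t + \<eta>} f = integral {0..t} f + integral {t..t + \<eta>} f"
      if "continuous_on {0..t + \<eta>} f" for f :: "real \<Rightarrow> real"
      using that t \<eta> by (intro combine[symmetric] integrable_continuous_real) auto
    note this[OF u_on[OF order_refl]] this[OF E_cont_on[OF order_refl]]
      this[OF Gh[OF order_refl order_refl]]
    ultimately show ?thesis
      using sol[of t] sol[of "t + \<eta>"] t \<eta> by (simp add: algebra_simps)
  qed
  have "\<bar>\<eta> * u t\<bar> \<le> \<bar>u0\<bar> * (\<eta> * E t) + \<eta> * (N * E (t - T) / l + M / l) + \<eta> * (\<epsilon> / 2) + \<eta> * (\<epsilon> / 2)"
    using past recent initial average increment by linarith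
  also have "\<dots> = \<eta> * (\<bar>u0\<bar> * E t + N * E (t - T) / l + M / l + \<epsilon>)"
    by (simp add: algebra_simps)
  finally show "\<bar>u t\<bar> \<le> \<bar>u0\<bar> * E t + N * E (t - T) / l + M / l + \<epsilon>"
    using \<eta>(1) by (simp add: abs_mult)
qed

end

section \<open>The Maxwell-Bloch system\<close>

lemma fractional_relaxation_exists:
  assumes "0 < \<alpha>" "\<alpha> < 1" "0 < l"
  obtains E where "fractional_relaxation \<alpha> l E"
proof -
  have "norm (- l * x - - l * y) \<le> l * norm (x - y)" for x y :: real
    using assms abs_mult[of l "y - x"] by (simp add: algebra_simps abs_minus_commute)
  from caputo_solution_exists_Lipschitz[OF assms(1) _ this]
  obtain E where "caputo_solution \<alpha> (\<lambda>x. - l * x) 1 E"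
    by auto
  then have "fractional_relaxation \<alpha> l E"
    using assms RL_integral_cmul[of \<alpha> "- l" E]
    by unfold_locales (auto simp: caputo_solution_def)
  then show thesis by (rule that)
qed

text \<open>This is the case \<open>T = 0\<close>, \<open>N = 0\<close> of the general bound, with
  \<open>E\<close> at most 1. The common rate \<kappa> below the individual dampings lets one
  estimate serve all components.\<close>

lemma damped_bound:
  fixes u h :: "real \<Rightarrow> real"
  assumes "0 < \<alpha>" "\<alpha> < 1" and \<kappa>: "0 < \<kappa>" "\<kappa> \<le> l"
    and u: "continuous_on {0..} u" and h: "continuous_on {0..} h"
    and eq: "\<And>t. 0 \<le> t \<Longrightarrow> u t = u0 + RL_integral \<alpha> (\<lambda>s. h s - l * u s) t"
    and t: "0 \<le> t" and M: "\<And>s. 0 \<le> s \<Longrightarrow> s \<le> t \<Longrightarrow> \<bar>h s\<bar> \<le> M"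
  shows "\<bar>u t\<bar> \<le> \<bar>u0\<bar> + M / \<kappa>"
proof -
  obtain E where "fractional_relaxation \<alpha> l E"
    using fractional_relaxation_exists assms by (metis less_le_trans)
  then interpret fractional_relaxation \<alpha> l E .
  have "\<bar>u t\<bar> \<le> \<bar>u0\<bar> * E t + 0 * E (t - 0) / l + M / l"
    using t M by (intro solution_bound[OF u h eq]) auto
  also have "\<dots> \<le> \<bar>u0\<bar> * 1 + 0 + M / \<kappa>"
    using E_decreasing[of 0 t] E_0 t \<kappa> M[of 0]
    by (intro add_mono mult_left_mono divide_left_mono) auto
  finally show ?thesis by simp
qed

text \<open>The strict gap between \<open>M\<close> and \<open>M'\<close> absorbs the initial value
  and the forcing from before the bound \<open>M\<close> sets in: both carry a factor
  \<open>E\<close> and die out.\<close>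

lemma damped_eventually_bound:
  fixes u h :: "real \<Rightarrow> real"
  assumes "0 < \<alpha>" "\<alpha> < 1" and \<kappa>: "0 < \<kappa>" "\<kappa> \<le> l"
    and u: "continuous_on {0..} u" and h: "continuous_on {0..} h"
    and eq: "\<And>t. 0 \<le> t \<Longrightarrow> u t = u0 + RL_integral \<alpha> (\<lambda>s. h s - l * u s) t"
    and N: "\<And>s. 0 \<le> s \<Longrightarrow> \<bar>h s\<bar> \<le> N"
    and M: "eventually (\<lambda>t. \<bar>h t\<bar> \<le> M) at_top" and M': "M < M'"
  shows "eventually (\<lambda>t. \<bar>u t\<bar> \<le> M' / \<kappa>) at_top"
proof -
  obtain E where "fractional_relaxation \<alpha> l E"
    using fractional_relaxation_exists assms by (metis less_le_trans)
  then interpret fractional_relaxation \<alpha> l E .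
  have "0 \<le> N" using N[of 0] by simp
  obtain T0 where T0: "\<And>t. T0 \<le> t \<Longrightarrow> \<bar>h t\<bar> \<le> M"
    using M by (auto simp: eventually_at_top_linorder)
  define T where "T = max 0 T0"
  have T: "0 \<le> T" "\<And>t. T \<le> t \<Longrightarrow> \<bar>h t\<bar> \<le> M"
    using T0 by (auto simp: T_def)
  have "0 \<le> M" using T(2)[of T] by simp
  have "((\<lambda>t. E (t - T)) \<longlongrightarrow> 0) at_top"
    using E_tendsto_0 by (rule filterlim_compose) real_asymp
  then have "((\<lambda>t. \<bar>u0\<bar> * E t + N * E (t - T) / l + M / l) \<longlongrightarrow> \<bar>u0\<bar> * 0 + N * 0 / l + M / l) at_top"
    using l by (intro tendsto_intros E_tendsto_0) auto
  moreover have "M / l < M' / l" using M' l by (simp add: divide_strict_right_mono)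
  ultimately have "eventually (\<lambda>t. \<bar>u0\<bar> * E t + N * E (t - T) / l + M / l < M' / l) at_top"
    by (intro order_tendstoD(2)) auto
  with eventually_ge_at_top[of T] show ?thesis
  proof eventually_elim
    case (elim t)
    have "\<bar>h s\<bar> \<le> N + M" if "0 \<le> s" for s
      using N[OF that] \<open>0 \<le> M\<close> by linarith
    then have "\<bar>u t\<bar> \<le> \<bar>u0\<bar> * E t + N * E (t - T) / l + M / l"
      using T elim \<open>0 \<le> N\<close> by (intro solution_bound[OF u h eq]) auto
    also have "\<dots> \<le> M' / l" using elim by simp
    also have "\<dots> \<le> M' / \<kappa>"
      using \<kappa> l \<open>0 \<le> M\<close> M' by (intro divide_left_mono) auto
    finally show ?case .
  qed
qed

section \<open>Invariance and decay for small data\<close>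

lemma forall_5: "(\<forall>i::5. P i) \<longleftrightarrow> P 1 \<and> P 2 \<and> P 3 \<and> P 4 \<and> P 5"
proof -
  have "(\<forall>i. P i) \<longleftrightarrow> (\<forall>i\<in>UNIV. P i)" by simp
  then show ?thesis unfolding UNIV_5 by simp
qed

text \<open>The quadratic terms enter only through their moduli, so that the locale covers both the original
  system and its truncation.\<close>

locale damped_maxwell_bloch =
  fixes \<alpha> \<kappa> \<rho> :: real and k x0 :: "real^5" and x :: "real \<Rightarrow> real^5" and h3 h4 h5 :: "real \<Rightarrow> real"
  assumes \<alpha>: "0 < \<alpha>" "\<alpha> < 1"
    and \<kappa>: "0 < \<kappa>" "\<kappa> \<le> 1" "\<kappa> \<le> k $ i"
    and \<rho>: "0 < \<rho>" "8 * \<rho> \<le> \<kappa>\<^sup>2"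
    and x0: "\<bar>x0 $ i\<bar> \<le> \<kappa> * \<rho> / 4"
    and x_cont: "continuous_on {0..} x"
    and h_cont: "continuous_on {0..} h3" "continuous_on {0..} h4" "continuous_on {0..} h5"
    and x1: "0 \<le> t \<Longrightarrow> x t $ 1 = x0 $ 1 + RL_integral \<alpha> (\<lambda>s. x s $ 3 - k $ 1 * x s $ 1) t"
    and x2: "0 \<le> t \<Longrightarrow> x t $ 2 = x0 $ 2 + RL_integral \<alpha> (\<lambda>s. x s $ 4 - k $ 2 * x s $ 2) t"
    and x3: "0 \<le> t \<Longrightarrow> x t $ 3 = x0 $ 3 + RL_integral \<alpha> (\<lambda>s. h3 s - k $ 3 * x s $ 3) t"
    and x4: "0 \<le> t \<Longrightarrow> x t $ 4 = x0 $ 4 + RL_integral \<alpha> (\<lambda>s. h4 s - k $ 4 * x s $ 4) t"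
    and x5: "0 \<le> t \<Longrightarrow> x t $ 5 = x0 $ 5 + RL_integral \<alpha> (\<lambda>s. h5 s - k $ 5 * x s $ 5) t"
    and h3: "\<bar>h3 t\<bar> \<le> \<bar>x t $ 1\<bar> * \<bar>x t $ 5\<bar>"
    and h4: "\<bar>h4 t\<bar> \<le> \<bar>x t $ 2\<bar> * \<bar>x t $ 5\<bar>"
    and h5: "\<bar>h5 t\<bar> \<le> \<bar>x t $ 1\<bar> * \<bar>x t $ 3\<bar> + \<bar>x t $ 2\<bar> * \<bar>x t $ 4\<bar>"
begin

lemma component_cont: "continuous_on {0..} (\<lambda>t. x t $ i)"
  by (intro continuous_intros x_cont)

text \<open>The factor 2 counts the two products in \<open>h5\<close>. Linearity in \<open>m\<close>
  is what matters: m = \<rho> gives invariance, ever smaller \<open>m\<close> give decay.\<close>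

lemma coupling_bound:
  assumes "\<bar>x t $ 1\<bar> \<le> \<rho>" "\<bar>x t $ 2\<bar> \<le> \<rho>" "\<bar>x t $ 3\<bar> \<le> m" "\<bar>x t $ 4\<bar> \<le> m" "\<bar>x t $ 5\<bar> \<le> m"
  shows "\<bar>h3 t\<bar> \<le> 2 * \<rho> * m" "\<bar>h4 t\<bar> \<le> 2 * \<rho> * m" "\<bar>h5 t\<bar> \<le> 2 * \<rho> * m"
proof -
  have *: "\<bar>x t $ i\<bar> * \<bar>x t $ j\<bar> \<le> \<rho> * m" if "i \<in> {1, 2}" "j \<in> {3, 4, 5}" for i j
    using that assms \<rho> by (intro mult_mono) auto
  have "0 \<le> \<rho> * m" using *[of 1 3] by (rule order_trans[rotated]) auto
  then have m: "\<rho> * m \<le> 2 * \<rho> * m" by simp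
  have "\<bar>x t $ 1\<bar> * \<bar>x t $ 5\<bar> \<le> \<rho> * m" "\<bar>x t $ 2\<bar> * \<bar>x t $ 5\<bar> \<le> \<rho> * m"
    by (rule *; simp)+
  then show "\<bar>h3 t\<bar> \<le> 2 * \<rho> * m" "\<bar>h4 t\<bar> \<le> 2 * \<rho> * m"
    using order_trans[OF h3] order_trans[OF h4] m order_trans by blast+
  have "\<bar>x t $ 1\<bar> * \<bar>x t $ 3\<bar> + \<bar>x t $ 2\<bar> * \<bar>x t $ 4\<bar> \<le> \<rho> * m + \<rho> * m"
    by (rule add_mono; rule *; simp)
  also have "\<dots> = 2 * \<rho> * m" by simp
  finally show "\<bar>h5 t\<bar> \<le> 2 * \<rho> * m"
    by (rule order_trans[OF h5])
qed

text \<open>Consider the first time \<open>T\<close> at which some component reaches \<rho>. Up to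
  then the couplings are at most 2 \<rho>^2, so components 3, 4, 5 stay below \<kappa> \<rho> / 4 +
  2 \<rho>^2 / \<kappa>, which is at most \<kappa> \<rho> / 2 because 8 \<rho> \<le> \<kappa>^2. As
  forcing, this keeps components 1 and 2 below \<kappa> \<rho> / 4 + \<rho> / 2 < \<rho>, a
  contradiction. The constants in the locale are those that close this loop.\<close>

lemma component_less:
  assumes "0 \<le> t" shows "\<bar>x t $ i\<bar> < \<rho>"
proof (rule ccontr)
  assume neg: "\<not> \<bar>x t $ i\<bar> < \<rho>"
  define Z where "Z = (\<Union>i. {0..} \<inter> (\<lambda>t. \<bar>x t $ i\<bar>) -` {\<rho>..})"
  have "closed Z"
    unfolding Z_def
    by (intro closed_UN ballI continuous_closed_preimage continuous_intros x_cont) auto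
  moreover have "Z \<noteq> {}" "bdd_below Z"
    using neg assms by (auto simp: Z_def not_less)
  ultimately have Z: "Inf Z \<in> Z"
    by (intro closed_contains_Inf) auto
  define T where "T = Inf Z"
  obtain j where T: "0 \<le> T" "\<rho> \<le> \<bar>x T $ j\<bar>"
    using Z by (auto simp: Z_def T_def)
  have less: "\<bar>x s $ i\<bar> < \<rho>" if "0 \<le> s" "s < T" for s i
  proof (rule ccontr)
    assume "\<not> \<bar>x s $ i\<bar> < \<rho>"
    then have "s \<in> Z" using that by (auto simp: Z_def not_less)
    then show False using cInf_lower[of s Z] \<open>bdd_below Z\<close> that by (simp add: T_def)
  qed
  have \<kappa>\<rho>: "\<kappa> * \<rho> \<le> \<rho>"
    using \<kappa> \<rho> mult_right_mono[of \<kappa> 1 \<rho>] by simp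
  have init: "x 0 = x0"
    unfolding vec_eq_iff forall_5 using x1[of 0] x2[of 0] x3[of 0] x4[of 0] x5[of 0] by simp
  have "\<bar>x 0 $ j\<bar> < \<rho>"
    unfolding init using x0[of j] \<kappa>\<rho> \<rho>(1) by linarith
  then have "T \<noteq> 0" using T by auto
  then have "0 < T" using T by simp
  then have clos: "closure {0..<T} = {0..T}" by (simp add: closure_atLeastLessThan)
  \<comment> \<open>The scalar bounds are used at \<open>T\<close> itself and need the forcing on
    the closed interval; continuity extends the bound to \<open>T\<close> at the price of
    strictness.\<close>
  have le: "\<bar>x s $ i\<bar> \<le> \<rho>" if "0 \<le> s" "s \<le> T" for s i
  proof (rule continuous_le_on_closure[of "{0..<T}" "\<lambda>s. \<bar>x s $ i\<bar>"])
    show "continuous_on (closure {0..<T}) (\<lambda>s. \<bar>x s $ i\<bar>)"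
      unfolding clos by (intro continuous_intros continuous_on_subset[OF x_cont]) auto
    show "s \<in> closure {0..<T}" unfolding clos using that by simp
    show "\<bar>x r $ i\<bar> \<le> \<rho>" if "r \<in> {0..<T}" for r
      using that less[of r i] by simp
  qed
  have small: "2 * \<rho> * \<rho> / \<kappa> \<le> \<kappa> * \<rho> / 4"
    using \<kappa> \<rho> mult_right_mono[of "8 * \<rho>" "\<kappa>\<^sup>2" \<rho>] by (simp add: field_simps power2_eq_square)
  have b': "\<bar>x s $ 3\<bar> \<le> \<bar>x0 $ 3\<bar> + 2 * \<rho> * \<rho> / \<kappa>" "\<bar>x s $ 4\<bar> \<le> \<bar>x0 $ 4\<bar> + 2 * \<rho> * \<rho> / \<kappa>"
    "\<bar>x s $ 5\<bar> \<le> \<bar>x0 $ 5\<bar> + 2 * \<rho> * \<rho> / \<kappa>" if s: "0 \<le> s" "s \<le> T" for s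
  proof -
    have c: "\<bar>h3 r\<bar> \<le> 2 * \<rho> * \<rho>" "\<bar>h4 r\<bar> \<le> 2 * \<rho> * \<rho>" "\<bar>h5 r\<bar> \<le> 2 * \<rho> * \<rho>"
      if "0 \<le> r" "r \<le> s" for r
      using that s by (intro coupling_bound le; simp)+
    show "\<bar>x s $ 3\<bar> \<le> \<bar>x0 $ 3\<bar> + 2 * \<rho> * \<rho> / \<kappa>"
      by (rule damped_bound[OF \<alpha> \<kappa>(1) \<kappa>(3) component_cont h_cont(1) x3 s(1) c(1)])
    show "\<bar>x s $ 4\<bar> \<le> \<bar>x0 $ 4\<bar> + 2 * \<rho> * \<rho> / \<kappa>"
      by (rule damped_bound[OF \<alpha> \<kappa>(1) \<kappa>(3) component_cont h_cont(2) x4 s(1) c(2)])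
    show "\<bar>x s $ 5\<bar> \<le> \<bar>x0 $ 5\<bar> + 2 * \<rho> * \<rho> / \<kappa>"
      by (rule damped_bound[OF \<alpha> \<kappa>(1) \<kappa>(3) component_cont h_cont(3) x5 s(1) c(3)])
  qed
  have b: "\<bar>x s $ 3\<bar> \<le> \<kappa> * \<rho> / 2" "\<bar>x s $ 4\<bar> \<le> \<kappa> * \<rho> / 2" "\<bar>x s $ 5\<bar> \<le> \<kappa> * \<rho> / 2"
    if "0 \<le> s" "s \<le> T" for s
    using b'[OF that] small x0[of 3] x0[of 4] x0[of 5] by linarith+
  have quot: "\<kappa> * \<rho> / 2 / \<kappa> = \<rho> / 2" using \<kappa> by simp
  have "\<bar>x T $ 1\<bar> \<le> \<bar>x0 $ 1\<bar> + \<kappa> * \<rho> / 2 / \<kappa>"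
    by (rule damped_bound[OF \<alpha> \<kappa>(1) \<kappa>(3) component_cont component_cont x1 T(1) b(1)])
  moreover have "\<bar>x T $ 2\<bar> \<le> \<bar>x0 $ 2\<bar> + \<kappa> * \<rho> / 2 / \<kappa>"
    by (rule damped_bound[OF \<alpha> \<kappa>(1) \<kappa>(3) component_cont component_cont x2 T(1) b(2)])
  ultimately have "\<bar>x T $ 1\<bar> < \<rho>" "\<bar>x T $ 2\<bar> < \<rho>"
    using x0[of 1] x0[of 2] \<kappa>\<rho> \<rho>(1) unfolding quot by linarith+
  moreover have "\<bar>x T $ 3\<bar> < \<rho>" "\<bar>x T $ 4\<bar> < \<rho>" "\<bar>x T $ 5\<bar> < \<rho>"
    using b[OF T(1) order_refl] \<kappa>\<rho> \<rho>(1) by linarith+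
  ultimately have "\<forall>i. \<bar>x T $ i\<bar> < \<rho>"
    unfolding forall_5 by simp
  then have "\<bar>x T $ j\<bar> < \<rho>" by blast
  then show False using T by simp
qed

lemma component_le: "0 \<le> t \<Longrightarrow> \<bar>x t $ i\<bar> \<le> \<rho>"
  using component_less[of t i] by simp

lemma coupling_bounded:
  assumes "0 \<le> t"
  shows "\<bar>h3 t\<bar> \<le> 2 * \<rho> * \<rho>" "\<bar>h4 t\<bar> \<le> 2 * \<rho> * \<rho>" "\<bar>h5 t\<bar> \<le> 2 * \<rho> * \<rho>"
  by (rule coupling_bound[OF component_le component_le component_le component_le component_le]; fact)+

lemma eventually_halved:
  "eventually (\<lambda>t. \<bar>x t $ 3\<bar> \<le> \<rho> / 2 ^ n \<and> \<bar>x t $ 4\<bar> \<le> \<rho> / 2 ^ n \<and> \<bar>x t $ 5\<bar> \<le> \<rho> / 2 ^ n) at_top"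
proof (induction n)
  case 0
  show ?case
    using eventually_ge_at_top[of 0] by eventually_elim (simp add: component_le)
next
  case (Suc n)
  define m where "m = \<rho> / 2 ^ n"
  have m: "0 < m" using \<rho> by (simp add: m_def)
  have "eventually (\<lambda>t. \<bar>h3 t\<bar> \<le> 2 * \<rho> * m \<and> \<bar>h4 t\<bar> \<le> 2 * \<rho> * m \<and> \<bar>h5 t\<bar> \<le> 2 * \<rho> * m) at_top"
    using Suc[folded m_def] eventually_ge_at_top[of 0]
    by eventually_elim (simp add: coupling_bound component_le)
  then have ev: "eventually (\<lambda>t. \<bar>h3 t\<bar> \<le> 2 * \<rho> * m) at_top" "eventually (\<lambda>t. \<bar>h4 t\<bar> \<le> 2 * \<rho> * m) at_top"
      "eventually (\<lambda>t. \<bar>h5 t\<bar> \<le> 2 * \<rho> * m) at_top"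
    by (simp_all add: eventually_conj_iff)
  have "\<kappa>\<^sup>2 \<le> \<kappa>"
    using \<kappa> mult_left_mono[of \<kappa> 1 \<kappa>] by (simp add: power2_eq_square)
  \<comment> \<open>Indeed 2 \<rho> \<le> \<kappa>^2 / 4 \<le> \<kappa> / 4. The forcing 2 \<rho> m
    thus lies strictly below \<kappa> m / 2, and dividing by \<kappa> turns the level
    \<open>m\<close> into m / 2.\<close>
  then have "2 * \<rho> < \<kappa> / 2" using \<rho> by linarith
  then have lt: "2 * \<rho> * m < \<kappa> / 2 * m"
    using m by (rule mult_strict_right_mono)
  have half: "\<kappa> / 2 * m / \<kappa> = \<rho> / 2 ^ Suc n"
    using \<kappa> by (simp add: m_def)
  have "eventually (\<lambda>t. \<bar>x t $ 3\<bar> \<le> \<kappa> / 2 * m / \<kappa>) at_top"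
    by (rule damped_eventually_bound[OF \<alpha> \<kappa>(1) \<kappa>(3) component_cont h_cont(1) x3
          coupling_bounded(1) ev(1) lt])
  moreover have "eventually (\<lambda>t. \<bar>x t $ 4\<bar> \<le> \<kappa> / 2 * m / \<kappa>) at_top"
    by (rule damped_eventually_bound[OF \<alpha> \<kappa>(1) \<kappa>(3) component_cont h_cont(2) x4
          coupling_bounded(2) ev(2) lt])
  moreover have "eventually (\<lambda>t. \<bar>x t $ 5\<bar> \<le> \<kappa> / 2 * m / \<kappa>) at_top"
    by (rule damped_eventually_bound[OF \<alpha> \<kappa>(1) \<kappa>(3) component_cont h_cont(3) x5
          coupling_bounded(3) ev(3) lt])
  ultimately show ?case
    unfolding half by eventually_elim simp
qed

text \<open>Components 1 and 2 are forced linearly by components 3 and 4 and so follow them: once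
  these are below \<kappa> e / 2, strictly less than \<kappa> e, the scalar bound gives
  \<open>e\<close>.\<close>

lemma eventually_small:
  assumes "0 < e" shows "eventually (\<lambda>t. \<forall>i. \<bar>x t $ i\<bar> \<le> e) at_top"
proof -
  have late: "eventually (\<lambda>t. \<bar>x t $ 3\<bar> \<le> d \<and> \<bar>x t $ 4\<bar> \<le> d \<and> \<bar>x t $ 5\<bar> \<le> d) at_top" if "0 < d" for d
  proof -
    obtain n where "\<rho> / d < 2 ^ n"
      using real_arch_pow[of 2 "\<rho> / d"] by auto
    then have "\<rho> / 2 ^ n \<le> d"
      using that by (simp add: field_simps)
    then show ?thesis
      using eventually_halved[of n] by (auto elim!: eventually_mono)
  qed
  have \<kappa>e: "\<kappa> * e / \<kappa> = e" using \<kappa> by simp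
  have "0 < \<kappa> * e" using \<kappa> assms by simp
  then have lt: "\<kappa> * e / 2 < \<kappa> * e" by simp
  have l: "eventually (\<lambda>t. \<bar>x t $ 3\<bar> \<le> \<kappa> * e / 2) at_top" "eventually (\<lambda>t. \<bar>x t $ 4\<bar> \<le> \<kappa> * e / 2) at_top"
    using late[of "\<kappa> * e / 2"] \<open>0 < \<kappa> * e\<close> by (auto elim: eventually_mono)
  have "eventually (\<lambda>t. \<bar>x t $ 1\<bar> \<le> \<kappa> * e / \<kappa>) at_top"
    by (rule damped_eventually_bound[OF \<alpha> \<kappa>(1) \<kappa>(3) component_cont component_cont x1
          component_le l(1) lt])
  moreover have "eventually (\<lambda>t. \<bar>x t $ 2\<bar> \<le> \<kappa> * e / \<kappa>) at_top"
    by (rule damped_eventually_bound[OF \<alpha> \<kappa>(1) \<kappa>(3) component_cont component_cont x2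
          component_le l(2) lt])
  ultimately show ?thesis
    using late[OF assms] unfolding forall_5 \<kappa>e by eventually_elim simp
qed

lemma tendsto_0: "((\<lambda>t. norm (x t)) \<longlongrightarrow> 0) at_top"
proof -
  have "((\<lambda>t. x t $ i) \<longlongrightarrow> 0) at_top" for i
  proof (rule tendstoI)
    fix e :: real assume "0 < e"
    then show "eventually (\<lambda>t. dist (x t $ i) 0 < e) at_top"
      using eventually_small[of "e / 2"] by (auto elim!: eventually_mono dest: spec[of _ i])
  qed
  then have "(x \<longlongrightarrow> 0) at_top"
    by (intro vec_tendstoI) simp
  then show ?thesis by (rule tendsto_norm_zero)
qed

lemma norm_less:
  assumes "0 \<le> t" shows "norm (x t) < 5 * \<rho>"
proof -
  have "norm (x t) \<le> (\<Sum>i\<in>UNIV. \<bar>x t $ i\<bar>)" by (rule norm_le_l1_cart)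
  also have "\<dots> < (\<Sum>i\<in>(UNIV::5 set). \<rho>)"
    using component_less[OF assms] by (intro sum_strict_mono) auto
  finally show ?thesis by simp
qed

end

lemma continuous_on_vec_nthI:
  fixes f :: "'a::topological_space \<Rightarrow> 'b::topological_space ^ 'n"
  assumes "\<And>i. continuous_on S (\<lambda>x. f x $ i)"
  shows "continuous_on S f"
  using continuous_on_vec_lambda[of S "\<lambda>i x. f x $ i"] assms by simp

lemma caputo_solution_component:
  fixes f :: "real^'n \<Rightarrow> real^'n"
  assumes "0 < \<alpha>" and x: "caputo_solution \<alpha> f x0 x" and f: "continuous_on UNIV f" and "0 \<le> t"
  shows "x t $ i = x0 $ i + RL_integral \<alpha> (\<lambda>s. f (x s) $ i) t"
proof -
  have "continuous_on {0..t} (\<lambda>s. f (x s))"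
    using x unfolding caputo_solution_def
    by (intro continuous_on_compose2[OF f]) (auto intro: continuous_on_subset)
  with x \<open>0 \<le> t\<close> show ?thesis
    by (simp add: caputo_solution_def RL_integral_vec_nth[OF \<open>0 < \<alpha>\<close>])
qed

section \<open>The vector field and its truncation\<close>

lemma controlled_maxwell_bloch_nth:
  "controlled_maxwell_bloch k x $ 1 = x $ 3 - k $ 1 * x $ 1"
  "controlled_maxwell_bloch k x $ 2 = x $ 4 - k $ 2 * x $ 2"
  "controlled_maxwell_bloch k x $ 3 = x $ 1 * x $ 5 - k $ 3 * x $ 3"
  "controlled_maxwell_bloch k x $ 4 = x $ 2 * x $ 5 - k $ 4 * x $ 4"
  "controlled_maxwell_bloch k x $ 5 = - (x $ 1 * x $ 3 + x $ 2 * x $ 4) - k $ 5 * x $ 5"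
  by (simp_all only: controlled_maxwell_bloch_def vector_5)

lemma controlled_maxwell_bloch_0: "controlled_maxwell_bloch k 0 = 0"
  by (simp add: vec_eq_iff forall_5 controlled_maxwell_bloch_nth)

definition clamp_real :: "real \<Rightarrow> real \<Rightarrow> real" where
  "clamp_real \<rho> a = max (- \<rho>) (min \<rho> a)"

lemma abs_clamp_real_le: "0 \<le> \<rho> \<Longrightarrow> \<bar>clamp_real \<rho> a\<bar> \<le> \<bar>a\<bar>" "0 \<le> \<rho> \<Longrightarrow> \<bar>clamp_real \<rho> a\<bar> \<le> \<rho>"
  and clamp_real_id: "\<bar>a\<bar> \<le> \<rho> \<Longrightarrow> clamp_real \<rho> a = a"
  and clamp_real_Lipschitz: "\<bar>clamp_real \<rho> a - clamp_real \<rho> b\<bar> \<le> \<bar>a - b\<bar>"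
  by (auto simp: clamp_real_def max_def min_def)

lemma continuous_on_clamp_real [continuous_intros]:
  "continuous_on S f \<Longrightarrow> continuous_on S (\<lambda>x. clamp_real \<rho> (f x))"
  unfolding clamp_real_def by (intro continuous_intros)

text \<open>Unlike the plain product, the clamped one is globally Lipschitz: in the usual splitting
  of a difference of products the undifferenced factors are at most \<rho>.\<close>

lemma clamp_real_mult_Lipschitz:
  assumes "0 \<le> \<rho>" "\<bar>a - c\<bar> \<le> d" "\<bar>b - e\<bar> \<le> d"
  shows "\<bar>clamp_real \<rho> a * clamp_real \<rho> b - clamp_real \<rho> c * clamp_real \<rho> e\<bar> \<le> 2 * \<rho> * d"
proof -
  have "clamp_real \<rho> a * clamp_real \<rho> b - clamp_real \<rho> c * clamp_real \<rho> e
      = clamp_real \<rho> a * (clamp_real \<rho> b - clamp_real \<rho> e) + (clamp_real \<rho> a - clamp_real \<rho> c) * clamp_real \<rho> e"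
    by (simp add: algebra_simps)
  also have "\<bar>\<dots>\<bar> \<le> \<bar>clamp_real \<rho> a\<bar> * \<bar>clamp_real \<rho> b - clamp_real \<rho> e\<bar>
      + \<bar>clamp_real \<rho> a - clamp_real \<rho> c\<bar> * \<bar>clamp_real \<rho> e\<bar>"
    by (rule order_trans[OF abs_triangle_ineq]) (simp only: abs_mult order_refl)
  also have "\<dots> \<le> \<rho> * d + d * \<rho>"
    using assms
    by (intro add_mono mult_mono abs_clamp_real_le order_trans[OF clamp_real_Lipschitz]) auto
  finally show ?thesis by simp
qed

text \<open>Only the quadratic terms are truncated: the linear damping survives, so that the a priori
  bounds of the untruncated system remain available.\<close>

definition truncated_maxwell_bloch :: "real \<Rightarrow> real^5 \<Rightarrow> real^5 \<Rightarrow> real^5" where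
  "truncated_maxwell_bloch \<rho> k x = vector
     [x$3 - k$1 * x$1,
      x$4 - k$2 * x$2,
      clamp_real \<rho> (x$1) * clamp_real \<rho> (x$5) - k$3 * x$3,
      clamp_real \<rho> (x$2) * clamp_real \<rho> (x$5) - k$4 * x$4,
      - (clamp_real \<rho> (x$1) * clamp_real \<rho> (x$3) + clamp_real \<rho> (x$2) * clamp_real \<rho> (x$4)) - k$5 * x$5]"

lemma truncated_maxwell_bloch_nth:
  "truncated_maxwell_bloch \<rho> k x $ 1 = x $ 3 - k $ 1 * x $ 1"
  "truncated_maxwell_bloch \<rho> k x $ 2 = x $ 4 - k $ 2 * x $ 2"
  "truncated_maxwell_bloch \<rho> k x $ 3 = clamp_real \<rho> (x $ 1) * clamp_real \<rho> (x $ 5) - k $ 3 * x $ 3"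
  "truncated_maxwell_bloch \<rho> k x $ 4 = clamp_real \<rho> (x $ 2) * clamp_real \<rho> (x $ 5) - k $ 4 * x $ 4"
  "truncated_maxwell_bloch \<rho> k x $ 5 =
    - (clamp_real \<rho> (x $ 1) * clamp_real \<rho> (x $ 3) + clamp_real \<rho> (x $ 2) * clamp_real \<rho> (x $ 4)) - k $ 5 * x $ 5"
  by (simp_all only: truncated_maxwell_bloch_def vector_5)

lemma truncated_maxwell_bloch_eq:
  assumes "\<And>i. \<bar>x $ i\<bar> \<le> \<rho>"
  shows "truncated_maxwell_bloch \<rho> k x = controlled_maxwell_bloch k x"
  by (simp add: vec_eq_iff forall_5 controlled_maxwell_bloch_nth truncated_maxwell_bloch_nth
      clamp_real_id assms)

lemma truncated_maxwell_bloch_Lipschitz: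
  assumes "0 \<le> \<rho>"
  obtains L where "\<And>x y. norm (truncated_maxwell_bloch \<rho> k x - truncated_maxwell_bloch \<rho> k y) \<le> L * norm (x - y)"
proof
  fix x y :: "real^5"
  define d where "d = norm (x - y)"
  define f where "f = truncated_maxwell_bloch \<rho> k"
  have d: "\<bar>x $ i - y $ i\<bar> \<le> d" for i
    using component_le_norm_cart[of "x - y" i] by (simp add: d_def)
  have "0 \<le> d" by (simp add: d_def)
  have lin: "\<bar>k $ i * x $ i - k $ i * y $ i\<bar> \<le> norm k * d" for i
  proof -
    have "\<bar>k $ i * x $ i - k $ i * y $ i\<bar> = \<bar>k $ i\<bar> * \<bar>x $ i - y $ i\<bar>"
      by (simp add: abs_mult[symmetric] right_diff_distrib)
    also have "\<dots> \<le> norm k * d"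
      using d component_le_norm_cart[of k i] by (intro mult_mono) auto
    finally show ?thesis .
  qed
  note quad = clamp_real_mult_Lipschitz[OF assms d d]
  have "0 \<le> \<rho> * d" using assms \<open>0 \<le> d\<close> by simp
  \<comment> \<open>The three terms pay for the linear coupling, for at most two clamped products,
    and for the damping.\<close>
  have "\<forall>i. \<bar>f x $ i - f y $ i\<bar> \<le> d + 4 * \<rho> * d + norm k * d"
    unfolding forall_5 f_def truncated_maxwell_bloch_nth
  proof (intro conjI)
    let ?c = "clamp_real \<rho>"
    show "\<bar>x $ 3 - k $ 1 * x $ 1 - (y $ 3 - k $ 1 * y $ 1)\<bar> \<le> d + 4 * \<rho> * d + norm k * d"
      using d[of 3] lin[of 1] \<open>0 \<le> \<rho> * d\<close> by linarith
    show "\<bar>x $ 4 - k $ 2 * x $ 2 - (y $ 4 - k $ 2 * y $ 2)\<bar> \<le> d + 4 * \<rho> * d + norm k * d"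
      using d[of 4] lin[of 2] \<open>0 \<le> \<rho> * d\<close> by linarith
    show "\<bar>?c (x $ 1) * ?c (x $ 5) - k $ 3 * x $ 3 - (?c (y $ 1) * ?c (y $ 5) - k $ 3 * y $ 3)\<bar>
        \<le> d + 4 * \<rho> * d + norm k * d"
      using quad[of 1 5] lin[of 3] \<open>0 \<le> d\<close> \<open>0 \<le> \<rho> * d\<close> by linarith
    show "\<bar>?c (x $ 2) * ?c (x $ 5) - k $ 4 * x $ 4 - (?c (y $ 2) * ?c (y $ 5) - k $ 4 * y $ 4)\<bar>
        \<le> d + 4 * \<rho> * d + norm k * d"
      using quad[of 2 5] lin[of 4] \<open>0 \<le> d\<close> \<open>0 \<le> \<rho> * d\<close> by linarith
    show "\<bar>- (?c (x $ 1) * ?c (x $ 3) + ?c (x $ 2) * ?c (x $ 4)) - k $ 5 * x $ 5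
          - (- (?c (y $ 1) * ?c (y $ 3) + ?c (y $ 2) * ?c (y $ 4)) - k $ 5 * y $ 5)\<bar>
        \<le> d + 4 * \<rho> * d + norm k * d"
      using quad[of 1 3] quad[of 2 4] lin[of 5] \<open>0 \<le> d\<close> by linarith
  qed
  \<comment> \<open>Bounding the Euclidean norm by the sum of five moduli gives the factor 5 in the
    constant.\<close>
  then have "(\<Sum>i\<in>UNIV. \<bar>(f x - f y) $ i\<bar>) \<le> (\<Sum>i\<in>(UNIV::5 set). d + 4 * \<rho> * d + norm k * d)"
    by (intro sum_mono) simp
  then show "norm (truncated_maxwell_bloch \<rho> k x - truncated_maxwell_bloch \<rho> k y)
      \<le> 5 * (1 + 4 * \<rho> + norm k) * norm (x - y)"
    using norm_le_l1_cart[of "f x - f y"] by (simp add: f_def d_def algebra_simps)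
qed

theorem proposition4p3:
  fixes \<alpha> :: real and k :: "real^5"
  assumes "0 < \<alpha>" and "\<alpha> < 1"
    and "\<forall>i. k $ i > 0"
  shows "equilibrium_state (controlled_maxwell_bloch k) 0
    \<and> locally_asymptotically_stable \<alpha> (controlled_maxwell_bloch k) 0"
proof -
  let ?f = "controlled_maxwell_bloch k"
  \<comment> \<open>The cap at 1 yields \<kappa> \<rho> \<le> \<rho> for the invariance and
    \<kappa>^2 \<le> \<kappa> for the halving.\<close>
  define \<kappa> where "\<kappa> = min 1 (Min (range (($) k)))"
  have \<kappa>: "0 < \<kappa>" "\<kappa> \<le> 1" "\<kappa> \<le> k $ i" for i
    using assms(3) by (auto simp: \<kappa>_def min.coboundedI2)
  have "\<forall>i. continuous_on UNIV (\<lambda>x. ?f x $ i)"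
    unfolding forall_5 controlled_maxwell_bloch_nth by (intro conjI continuous_intros)
  then have f_cont: "continuous_on UNIV ?f"
    by (intro continuous_on_vec_nthI) simp
  have small: "(\<exists>x. caputo_solution \<alpha> ?f x0 x) \<and>
      (\<forall>x. caputo_solution \<alpha> ?f x0 x \<longrightarrow>
        (\<forall>t\<ge>0. norm (x t) < 5 * \<rho>) \<and> ((\<lambda>t. norm (x t)) \<longlongrightarrow> 0) at_top)"
    if \<rho>: "0 < \<rho>" "8 * \<rho> \<le> \<kappa>\<^sup>2" and x0: "norm x0 < \<kappa> * \<rho> / 4" for \<rho> x0
  proof (intro conjI allI impI)
    have x0': "\<bar>x0 $ i\<bar> \<le> \<kappa> * \<rho> / 4" for i
      using component_le_norm_cart[of x0 i] x0 by linarith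
    show "\<exists>x. caputo_solution \<alpha> ?f x0 x"
    proof -
      let ?g = "truncated_maxwell_bloch \<rho> k" and ?c = "clamp_real \<rho>"
      obtain L where L: "\<And>x y. norm (?g x - ?g y) \<le> L * norm (x - y)"
        using truncated_maxwell_bloch_Lipschitz[of \<rho> k] \<rho> by auto
      have "?g 0 = 0"
        using \<rho> by (simp add: truncated_maxwell_bloch_eq controlled_maxwell_bloch_0)
      then obtain x where x: "caputo_solution \<alpha> ?g x0 x"
        using caputo_solution_exists_Lipschitz[OF assms(1) _ L] by blast
      then have x_cont: "continuous_on {0..} x"
        by (simp add: caputo_solution_def)
      have "\<forall>i. continuous_on UNIV (\<lambda>x. ?g x $ i)"
        unfolding forall_5 truncated_maxwell_bloch_nth by (intro conjI continuous_intros)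
      then have g_cont: "continuous_on UNIV ?g"
        by (intro continuous_on_vec_nthI) simp
      note component = caputo_solution_component[OF assms(1) x g_cont]
      note component = component[where i = 1] component[where i = 2] component[where i = 3]
        component[where i = 4] component[where i = 5]
      note component = component[unfolded truncated_maxwell_bloch_nth]
      interpret damped_maxwell_bloch \<alpha> \<kappa> \<rho> k x0 x "\<lambda>t. ?c (x t $ 1) * ?c (x t $ 5)"
        "\<lambda>t. ?c (x t $ 2) * ?c (x t $ 5)" "\<lambda>t. - (?c (x t $ 1) * ?c (x t $ 3) + ?c (x t $ 2) * ?c (x t $ 4))"
      proof unfold_locales
        fix t
        have *: "\<bar>?c a * ?c b\<bar> \<le> \<bar>a\<bar> * \<bar>b\<bar>" for a b
          using \<rho> by (auto simp: abs_mult intro!: mult_mono abs_clamp_real_le)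
        show "\<bar>- (?c (x t $ 1) * ?c (x t $ 3) + ?c (x t $ 2) * ?c (x t $ 4))\<bar>
            \<le> \<bar>x t $ 1\<bar> * \<bar>x t $ 3\<bar> + \<bar>x t $ 2\<bar> * \<bar>x t $ 4\<bar>"
          unfolding abs_minus_cancel by (intro order_trans[OF abs_triangle_ineq] add_mono *)
        show "\<bar>?c (x t $ 1) * ?c (x t $ 5)\<bar> \<le> \<bar>x t $ 1\<bar> * \<bar>x t $ 5\<bar>"
          "\<bar>?c (x t $ 2) * ?c (x t $ 5)\<bar> \<le> \<bar>x t $ 2\<bar> * \<bar>x t $ 5\<bar>"
          by (rule *)+
      qed (fact assms(1,2) \<kappa> \<rho> x0' x_cont | (rule component, assumption) | (intro continuous_intros x_cont))+
      \<comment> \<open>Clamping only lowers the moduli of the products, so the invariance holds for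
        the truncated solution. Within |x_i| \<le> \<rho> the two fields agree, and the same
        function solves the original Volterra equation.\<close>
      have "?g (x s) = ?f (x s)" if "0 \<le> s" for s
        by (intro truncated_maxwell_bloch_eq component_le that)
      then have "RL_integral \<alpha> (\<lambda>s. ?g (x s)) t = RL_integral \<alpha> (\<lambda>s. ?f (x s)) t" for t
        by (intro RL_integral_cong) simp
      then have "caputo_solution \<alpha> ?f x0 x"
        using x by (simp add: caputo_solution_def)
      then show ?thesis by blast
    qed
    fix x assume x: "caputo_solution \<alpha> ?f x0 x"
    then have x_cont: "continuous_on {0..} x"
      by (simp add: caputo_solution_def)
    note component = caputo_solution_component[OF assms(1) x f_cont]
    note component = component[where i = 1] component[where i = 2] component[where i = 3]
      component[where i = 4] component[where i = 5]
    note component = component[unfolded controlled_maxwell_bloch_nth]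
    interpret damped_maxwell_bloch \<alpha> \<kappa> \<rho> k x0 x "\<lambda>t. x t $ 1 * x t $ 5"
      "\<lambda>t. x t $ 2 * x t $ 5" "\<lambda>t. - (x t $ 1 * x t $ 3 + x t $ 2 * x t $ 4)"
    proof unfold_locales
      fix t
      show "\<bar>- (x t $ 1 * x t $ 3 + x t $ 2 * x t $ 4)\<bar> \<le> \<bar>x t $ 1\<bar> * \<bar>x t $ 3\<bar> + \<bar>x t $ 2\<bar> * \<bar>x t $ 4\<bar>"
        unfolding abs_minus_cancel abs_mult[symmetric] by (rule abs_triangle_ineq)
    qed (fact assms(1,2) \<kappa> \<rho> x0' x_cont | (rule component, assumption) | (intro continuous_intros x_cont) | simp add: abs_mult)+
    show "((\<lambda>t. norm (x t)) \<longlongrightarrow> 0) at_top"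
      by (rule tendsto_0)
    show "norm (x t) < 5 * \<rho>" if "0 \<le> t" for t
      using that by (rule norm_less)
  qed
  have "locally_attractive \<alpha> ?f 0"
    unfolding locally_attractive_def
    \<comment> \<open>This is the largest radius compatible with
      \<open>8 * \<rho> \<le> \<kappa>\<^sup>2\<close>.\<close>
    using small[of "\<kappa>\<^sup>2 / 8"] \<kappa>(1) by (intro exI[of _ "\<kappa> * (\<kappa>\<^sup>2 / 8) / 4"]) simp
  moreover have "lyapunov_stable \<alpha> ?f 0"
    unfolding lyapunov_stable_def
  proof (intro allI impI)
    fix \<epsilon> :: real assume "0 < \<epsilon>"
    \<comment> \<open>The second term matches the norm bound 5 \<rho>, the sum of five components
      below \<rho>.\<close>
    define \<rho> where "\<rho> = min (\<kappa>\<^sup>2 / 8) (\<epsilon> / 5)"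
    have \<rho>: "0 < \<rho>" "8 * \<rho> \<le> \<kappa>\<^sup>2" "5 * \<rho> \<le> \<epsilon>"
      using \<open>0 < \<epsilon>\<close> \<kappa>(1) by (auto simp: \<rho>_def min_def)
    show "\<exists>\<delta>>0. \<forall>x0. norm (x0 - 0) < \<delta> \<longrightarrow> (\<exists>x. caputo_solution \<alpha> ?f x0 x) \<and>
        (\<forall>x. caputo_solution \<alpha> ?f x0 x \<longrightarrow> (\<forall>t\<ge>0. norm (x t - 0) < \<epsilon>))"
      using small[OF \<rho>(1,2)] \<rho> \<kappa>(1)
      by (intro exI[of _ "\<kappa> * \<rho> / 4"]) (auto intro: less_le_trans)
  qed
  ultimately show ?thesis
    by (simp add: equilibrium_state_def locally_asymptotically_stable_def controlled_maxwell_bloch_0)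
qed

end
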